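(* Let $\mathbf Y=\{Y_n\}_{n\ge 0}$ be a branching process in i.i.d. random environment with one immigrant in each generation (BPIRE) whose random offspring generating function is geometric with probability 1, i.e. $F(s)=\frac{1}{1+e^{X}(1-s)}$ with $X=\log m(F)$, and which is strongly subcritical: $-\infty<\mathbf E[X]<0$ and $-\infty<\mathbf E[Xe^{X}]<0$. Let $\gamma:=\mathbf E[e^{X}]$, and let $\mathcal A_i(n)$, $0\le i\le n-1$, be the event that only the $(i,n)$-clan survives in $\mathbf Y$ at moment $n$. Then: 1) for any fixed $N\in\{1,2,\dots\}$ the limit $\lim_{n\to\infty}\mathbf P(\mathcal A_{n-N}(n))=:r_N$ exists and $r_N\in(0,\infty)$; 2) there exists a constant $R\in(0,\infty)$ such that $$\lim_{n-i\to\infty}\gamma^{-(n-i)}\,\mathbf P(\mathcal A_i(n))=R .$$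
   Context: Setting. $\Delta$ is the space of probability measures on $\mathbb N_0=\{0,1,2,\dots\}$ with the total variation metric (a Polish space). $F$ is a random element of $\Delta$ and $F_1,F_2,\dots$ are independent copies of $F$ (the random environment). For a measure $F$ write $F(s)=\sum_{j\ge0}F(\{j\})s^j$ for its generating function, $m(F)=\sum_{j\ge1}jF(\{j\})$, $X=\log m(F)$, and $X_n=\log m(F_n)$. "Geometric with probability 1" means $F(s)=\frac{q}{1-ps}$ with random $p,q\in(0,1)$, $p+q=1$, so that $m(F)=p/q=e^X$ and $F(s)=\frac1{1+e^X(1-s)}$. The BPIRE $\mathbf Y=\{Y_n,\ n\ge0\}$: $Y_0=1$ and, given the environment $F_i=f_i$, $i\ge1$, $\mathbf Y$ is a Markov chain in which, given $Y_{n-1}=y_{n-1}$, $Y_n$ is distributed as $\xi_{n1}+\dots+\xi_{ny_{n-1}}+1$, where $\xi_{n1},\xi_{n2},\dots$ are i.i.d. with distribution $f_n$. That is, the individuals of generation $n-1$ first reproduce independently according to $f_n$, and afterwards one immigrant enters generation $n$. The single individual at time $0$ is regarded as the immigrant of generation $0$. The $(i,n)$-clan is the set of individuals alive at generation $n$ that are descendants of the immigrant which entered the population at generation $i$. Put $Y_n^-:=\xi_{n1}+\dots+\xi_{nY_{n-1}}$ (the population at time $n$ just before the immigrant of generation $n$ arrives). $\mathcal A_i(n)$ is the event that $Y_n^->0$ and all these $Y_n^-$ individuals belong to the $(i,n)$-clan. The limit as $n-i\to\infty$ is over pairs of integers $0\le i<n$, with $i$ allowed to vary arbitrarily with $n$.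 *)

theory Defs
  imports "HOL-Probability.Probability"
begin

section \<open>Random elements of the space of offspring laws\<close>

definition tv_dist :: "nat pmf \<Rightarrow> nat pmf \<Rightarrow> real" where
  "tv_dist f g = (SUP A. \<bar>measure_pmf.prob f A - measure_pmf.prob g A\<bar>)"

definition pmf_borel :: "nat pmf measure" where
  "pmf_borel = sigma UNIV {U. \<forall>f\<in>U. \<exists>e>0. \<forall>g. tv_dist f g < e \<longrightarrow> g \<in> U}"

definition gen_fun :: "nat pmf \<Rightarrow> real \<Rightarrow> real" where
  "gen_fun f s = (\<Sum>j. pmf f j * s ^ j)"

text \<open>Meaningful only if the mean is finite, as it is for geometric laws.\<close>
definition offspring_mean :: "nat pmf \<Rightarrow> real" where
  "offspring_mean f = (\<Sum>j. real j * pmf f j)"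

definition geometric_law :: "nat pmf \<Rightarrow> bool" where
  "geometric_law f \<longleftrightarrow>
     (\<exists>p q. p \<in> {0<..<1} \<and> q \<in> {0<..<1} \<and> p + q = 1 \<and>
        (\<forall>s\<in>{0..1}. gen_fun f s = q / (1 - p * s)))"

section \<open>Genealogy\<close>

text \<open>
  Throughout, \<open>x n k\<close> (with \<open>n \<ge> 1\<close>) is the number of children, born into generation \<open>n\<close>, of the
  \<open>k\<close>-th individual of generation \<open>n - 1\<close>. The individuals of generation \<open>n\<close> are numbered
  \<open>0, \<dots>, pop x n - 1\<close>: first the children of individual \<open>0\<close>, then those of individual \<open>1\<close>, and so
  on; the immigrant of generation \<open>n\<close> comes last. The individual at time \<open>0\<close> is the immigrant of
  generation \<open>0\<close>.
\<close>

primrec pop :: "(nat \<Rightarrow> nat \<Rightarrow> nat) \<Rightarrow> nat \<Rightarrow> nat" where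
  "pop x 0 = 1"
| "pop x (Suc n) = (\<Sum>k<pop x n. x (Suc n) k) + 1"

text \<open>The population at time \<open>n \<ge> 1\<close> just before the immigrant of generation \<open>n\<close> arrives.\<close>
definition pop_before :: "(nat \<Rightarrow> nat \<Rightarrow> nat) \<Rightarrow> nat \<Rightarrow> nat" where
  "pop_before x n = (\<Sum>k<pop x (n - 1). x n k)"

definition children :: "(nat \<Rightarrow> nat \<Rightarrow> nat) \<Rightarrow> nat \<Rightarrow> nat \<Rightarrow> nat set" where
  "children x n k = {(\<Sum>j<k. x n j)..<(\<Sum>j\<le>k. x n j)}"

text \<open>\<open>clan x i n\<close> is the \<open>(i,n)\<close>-clan; it is empty for \<open>i > n\<close>.\<close>
primrec clan :: "(nat \<Rightarrow> nat \<Rightarrow> nat) \<Rightarrow> nat \<Rightarrow> nat \<Rightarrow> nat set" where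
  "clan x i 0 = (if i = 0 then {0} else {})"
| "clan x i (Suc n) =
     (if i = Suc n then {pop x (Suc n) - 1} else (\<Union>k\<in>clan x i n. children x (Suc n) k))"

definition only_clan_survives :: "(nat \<Rightarrow> nat \<Rightarrow> nat) \<Rightarrow> nat \<Rightarrow> nat \<Rightarrow> bool" where
  "only_clan_survives x i n \<longleftrightarrow> pop_before x n > 0 \<and> {..<pop_before x n} \<subseteq> clan x i n"

section \<open>Branching processes in i.i.d. random environment with immigration\<close>

definition env_algebra :: "'a measure \<Rightarrow> (nat \<Rightarrow> 'a \<Rightarrow> nat pmf) \<Rightarrow> 'a measure" where
  "env_algebra M Fs =
     vimage_algebra (space M) (\<lambda>\<omega>. \<lambda>n\<in>{1..}. Fs n \<omega>) (PiM {1..} (\<lambda>_. pmf_borel))"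

text \<open>
  \<open>Fs 1, Fs 2, \<dots>\<close> are independent copies of \<open>F\<close>, and given the environment the family
  \<open>\<xi> n k\<close> (\<open>n \<ge> 1\<close>, \<open>k \<ge> 0\<close>) is independent with \<open>\<xi> n k\<close> distributed according to \<open>Fs n\<close>; this
  is \<open>offspring_law\<close>. The process itself is \<open>pop\<close>, evaluated at \<open>\<lambda>n k. \<xi> n k \<omega>\<close>.
\<close>
locale bpire = prob_space M
  for M :: "'a measure" +
  fixes F :: "'a \<Rightarrow> nat pmf"
    and Fs :: "nat \<Rightarrow> 'a \<Rightarrow> nat pmf"
    and \<xi> :: "nat \<Rightarrow> nat \<Rightarrow> 'a \<Rightarrow> nat"
  assumes F_measurable: "F \<in> measurable M pmf_borel"
    and env_indep: "indep_vars (\<lambda>_. pmf_borel) Fs {1..}"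
    and env_distr: "\<And>n. n \<ge> 1 \<Longrightarrow> distr M pmf_borel (Fs n) = distr M pmf_borel F"
    and offspring_measurable: "\<And>n k. n \<ge> 1 \<Longrightarrow> \<xi> n k \<in> measurable M (count_space UNIV)"
    and offspring_law:
      "\<And>J x. finite J \<Longrightarrow> J \<subseteq> {1..} \<times> UNIV \<Longrightarrow>
         AE \<omega> in M.
           real_cond_exp M (env_algebra M Fs)
             (indicator {\<omega>\<in>space M. \<forall>(n, k)\<in>J. \<xi> n k \<omega> = x n k}) \<omega>
           = (\<Prod>(n, k)\<in>J. pmf (Fs n \<omega>) (x n k))"

definition clan_event ::
    "'a measure \<Rightarrow> (nat \<Rightarrow> nat \<Rightarrow> 'a \<Rightarrow> nat) \<Rightarrow> nat \<Rightarrow> nat \<Rightarrow> 'a set" where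
  "clan_event M \<xi> i n = {\<omega>\<in>space M. only_clan_survives (\<lambda>n k. \<xi> n k \<omega>) i n}"

end

theory Submission
  imports Defs "HOL-Complex_Analysis.Cauchy_Integral_Formula"
begin

text \<open>
  For geometric laws the composed generating functions are linear fractional. Reverse time and put
  \<open>x\<^sub>l = X\<^sub>n\<^sub>-\<^sub>l\<close>, \<open>W\<^sub>N = exp (x\<^sub>0 + \<dots> + x\<^sub>N\<^sub>-\<^sub>1)\<close> and \<open>A\<^sub>N = W\<^sub>0 + \<dots> + W\<^sub>N\<^sub>-\<^sub>1\<close>. Given the environment, the clan of
  the immigrant of generation \<open>n - N\<close> is extinct at time \<open>n\<close> with probability \<open>A\<^sub>N / A\<^sub>N\<^sub>+\<^sub>1\<close>. Clans evolve
  independently, the product telescopes, and with \<open>N = n - i\<close> the probability of interest is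
  \<open>E [W\<^sub>N / (A\<^sub>N A\<^sub>n\<^sub>+\<^sub>1)]\<close> for i.i.d. \<open>x\<^sub>l\<close>.

  For fixed \<open>N\<close> this decreases in \<open>n\<close>, and it stays away from \<open>0\<close> because \<open>E A\<^sub>n\<close> is bounded:
  \<open>\<gamma> \<le> 1 + E [X exp X] < 1\<close> by convexity.

  Tilting by \<open>\<gamma>\<^sup>-\<^sup>N W\<^sub>N\<close> gives a measure \<open>P'\<close>. The sequences \<open>a\<^sub>N = E' [1 / A\<^sub>N]\<close> and \<open>u\<^sub>N = E' [1 / A\<^sub>N\<^sup>2]\<close>
  decrease, and the normalised probability differs from \<open>u\<^sub>N\<close> by at most \<open>(a\<^sub>N - a\<^sub>N\<^sub>+\<^sub>1) / (1 - \<gamma>)\<close>,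
  uniformly in \<open>n\<close>, hence it has the limit of \<open>u\<^sub>N\<close>. That limit is positive since \<open>u\<^sub>N \<ge> a\<^sub>N\<^sup>2\<close> and
  \<open>a\<^sub>N \<ge> - E [X exp X]\<close>. The last bound comes from \<open>E' [ln A\<^sub>N] \<le> E' [ln A\<^sub>N\<^sub>+\<^sub>1]\<close>, the identity in law
  \<open>A\<^sub>N\<^sub>+\<^sub>1 = 1 + exp x\<^sub>0 A\<^sub>N\<close>, and \<open>exp x ln (1 + exp (- x) / a) \<le> 1 / a\<close>.
\<close>

section \<open>Exponential functionals of a random walk\<close>

definition walk_exp :: "nat \<Rightarrow> (nat \<Rightarrow> real) \<Rightarrow> real" where
  "walk_exp N x = exp (\<Sum>l<N. x l)"

definition walk_sum :: "nat \<Rightarrow> (nat \<Rightarrow> real) \<Rightarrow> real" where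
  "walk_sum N x = (\<Sum>k<N. walk_exp k x)"

lemma walk_exp_0 [simp]: "walk_exp 0 x = 1"
  and walk_exp_Suc: "walk_exp (Suc N) x = walk_exp N x * exp (x N)"
  and walk_exp_pos [simp]: "walk_exp N x > 0"
  by (simp_all add: walk_exp_def exp_add)

lemma walk_exp_nonneg [simp]: "0 \<le> walk_exp N x"
  by (simp add: less_imp_le)

lemma walk_sum_0 [simp]: "walk_sum 0 x = 0"
  and walk_sum_Suc: "walk_sum (Suc N) x = walk_sum N x + walk_exp N x"
  by (simp_all add: walk_sum_def)

lemma walk_sum_ge_1: "walk_sum (Suc N) x \<ge> 1"
proof (induction N)
  case (Suc N)
  have "0 < walk_exp (Suc N) x" by simp
  with Suc show ?case unfolding walk_sum_Suc[of "Suc N"] by linarith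
qed (simp add: walk_sum_Suc)

lemma walk_sum_pos: "N > 0 \<Longrightarrow> walk_sum N x > 0"
  using walk_sum_ge_1[of "N - 1" x] by simp

lemma walk_sum_mono: "N \<le> K \<Longrightarrow> walk_sum N x \<le> walk_sum K x"
  unfolding walk_sum_def by (intro sum_mono2) auto

lemma walk_exp_cong: "(\<And>l. l < N \<Longrightarrow> x l = y l) \<Longrightarrow> walk_exp N x = walk_exp N y"
  unfolding walk_exp_def by (intro arg_cong[where f = exp] sum.cong) auto

lemma walk_sum_cong: "(\<And>l. l + 1 < N \<Longrightarrow> x l = y l) \<Longrightarrow> walk_sum N x = walk_sum N y"
  unfolding walk_sum_def by (intro sum.cong refl walk_exp_cong) auto

lemma walk_exp_add: "walk_exp (N + K) x = walk_exp N x * walk_exp K (\<lambda>l. x (l + N))"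
  by (induction K) (simp_all add: walk_exp_Suc add.commute)

lemma walk_sum_add: "walk_sum (N + K) x = walk_sum N x + walk_exp N x * walk_sum K (\<lambda>l. x (l + N))"
proof (induction K)
  case (Suc K)
  then show ?case
    unfolding add_Suc_right walk_sum_Suc walk_exp_add[of N K] by (simp add: algebra_simps)
qed simp

lemma walk_exp_shift: "walk_exp (Suc N) x = exp (x 0) * walk_exp N (\<lambda>l. x (l + 1))"
  using walk_exp_add[of 1 N x] by (simp add: walk_exp_Suc)

lemma walk_sum_shift: "walk_sum (Suc N) x = 1 + exp (x 0) * walk_sum N (\<lambda>l. x (l + 1))"
  using walk_sum_add[of 1 N x] by (simp add: walk_exp_Suc walk_sum_Suc)

locale walk = sequence_space Q for Q :: "real measure" +
  assumes sets_Q [measurable_cong]: "sets Q = sets borel"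
begin

lemma borel_measurable_walk [measurable]:
  "walk_exp N \<in> borel_measurable S" "walk_sum N \<in> borel_measurable S"
  unfolding walk_exp_def walk_sum_def by measurable

lemma shift_measurable: "(\<lambda>x l. x (l + N)) \<in> S \<rightarrow>\<^sub>M S"
  by (intro measurable_PiM_single') (auto simp: space_PiM PiE_iff)

lemma
  fixes f g :: "(nat \<Rightarrow> real) \<Rightarrow> real"
  assumes f: "integrable S f" and g: "integrable S g"
    and past: "\<And>x y. (\<And>l. l < N \<Longrightarrow> x l = y l) \<Longrightarrow> f x = f y"
  shows integrable_past_future: "integrable S (\<lambda>x. f x * g (\<lambda>l. x (l + N)))" (is ?A)
    and integral_past_future: "(\<integral>x. f x * g (\<lambda>l. x (l + N)) \<partial>S) = (\<integral>x. f x \<partial>S) * (\<integral>x. g x \<partial>S)" (is ?B)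
proof -
  have [measurable]: "f \<in> borel_measurable S" "g \<in> borel_measurable S"
    using f g by auto
  note shift_measurable [measurable]
  interpret SS: pair_sigma_finite S S ..
  have eq: "f (comb_seq N x y) * g (\<lambda>l. comb_seq N x y (l + N)) = f x * g y" for x y
    using past[of "comb_seq N x y" x] by (simp add: comb_seq_less comb_seq_add)
  have int: "integrable (S \<Otimes>\<^sub>M S) (\<lambda>(x, y). f x * g y)"
  proof (rule SS.Fubini_integrable)
    show "integrable S (\<lambda>x. \<integral>y. norm (case (x, y) of (x, y) \<Rightarrow> f x * g y) \<partial>S)"
      using f by (simp add: abs_mult)
    show "AE x in S. integrable S (\<lambda>y. case (x, y) of (x, y) \<Rightarrow> f x * g y)"
      using g by simp
  qed measurable
  let ?D = "distr (S \<Otimes>\<^sub>M S) S (\<lambda>(x, y). comb_seq N x y)"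
  have "integrable ?D (\<lambda>x. f x * g (\<lambda>l. x (l + N)))"
    by (subst integrable_distr_eq) (use int in \<open>auto simp: eq split_beta'\<close>)
  then show ?A by (simp only: PiM_comb_seq)
  have "(\<integral>x. f x * g (\<lambda>l. x (l + N)) \<partial>?D) = (\<integral>z. (case z of (x, y) \<Rightarrow> f x * g y) \<partial>(S \<Otimes>\<^sub>M S))"
    by (subst integral_distr) (auto simp: eq split_beta')
  also have "\<dots> = (\<integral>x. (\<integral>y. f x * g y \<partial>S) \<partial>S)"
    using SS.integral_fst'[OF int] by simp
  also have "\<dots> = (\<integral>x. f x \<partial>S) * (\<integral>x. g x \<partial>S)" by simp
  finally show ?B by (simp only: PiM_comb_seq)
qed

lemma
  fixes h :: "real \<Rightarrow> real"
  assumes [measurable]: "h \<in> borel_measurable borel"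
  shows integrable_coordinate: "integrable S (\<lambda>x. h (x i)) \<longleftrightarrow> integrable Q h"
    and integral_coordinate: "(\<integral>x. h (x i) \<partial>S) = (\<integral>x. h x \<partial>Q)"
proof -
  have "integrable Q h \<longleftrightarrow> integrable (distr S Q (\<lambda>x. x i)) h"
    by (subst PiM_component) auto
  also have "\<dots> \<longleftrightarrow> integrable S (\<lambda>x. h (x i))"
    by (rule integrable_distr_eq) auto
  finally show "integrable S (\<lambda>x. h (x i)) \<longleftrightarrow> integrable Q h" by simp
  have "(\<integral>x. h x \<partial>Q) = (\<integral>x. h x \<partial>distr S Q (\<lambda>x. x i))"
    by (subst PiM_component) auto
  also have "\<dots> = (\<integral>x. h (x i) \<partial>S)"
    by (rule integral_distr) auto
  finally show "(\<integral>x. h (x i) \<partial>S) = (\<integral>x. h x \<partial>Q)" by simp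
qed

end

locale strongly_subcritical_walk = walk Q for Q :: "real measure" +
  fixes \<gamma> :: real
  defines "\<gamma> \<equiv> (\<integral>x. exp x \<partial>Q)"
  assumes integrable_tilted: "integrable Q (\<lambda>x. x * exp x)"
    and tilted_drift: "(\<integral>x. x * exp x \<partial>Q) < 0"
begin

lemma integrable_exp: "integrable Q exp"
proof (rule Bochner_Integration.integrable_bound)
  show "integrable Q (\<lambda>x. exp 1 + \<bar>x * exp x\<bar>)"
    using integrable_tilted by auto
  have "exp x \<le> exp 1 + \<bar>x * exp x\<bar>" for x :: real
  proof (cases "x \<le> 1")
    case False
    then have "exp x \<le> x * exp x" by simp
    then show ?thesis using exp_ge_zero[of 1] by linarith
  qed (simp add: add_increasing2)
  then show "AE x in Q. norm (exp x) \<le> norm (exp 1 + \<bar>x * exp x\<bar>)"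
    by (intro AE_I2) (simp add: add_increasing2)
qed measurable

lemma \<gamma>_pos: "\<gamma> > 0"
  unfolding \<gamma>_def using integrable_exp M.integral_less_AE_space[of "\<lambda>_. 0" exp]
  by (simp add: M.emeasure_space_1)

lemma \<gamma>_less_1: "\<gamma> < 1"
proof -
  have "exp x - x * exp x \<le> 1" for x :: real
  proof -
    have "exp x * (1 - x) \<le> exp x * exp (- x)"
      using exp_ge_add_one_self[of "-x"] by (intro mult_left_mono) auto
    then show ?thesis by (simp add: algebra_simps exp_minus)
  qed
  then have "(\<integral>x. exp x - x * exp x \<partial>Q) \<le> (\<integral>x. 1 \<partial>Q)"
    using integrable_exp integrable_tilted by (intro integral_mono) auto
  then have "\<gamma> - (\<integral>x. x * exp x \<partial>Q) \<le> 1"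
    using integrable_exp integrable_tilted by (simp add: \<gamma>_def M.prob_space)
  with tilted_drift show ?thesis by linarith
qed

lemma
  assumes f: "integrable S f" and past: "\<And>x y. (\<And>l. l < N \<Longrightarrow> x l = y l) \<Longrightarrow> f x = f y"
  shows integrable_past_exp: "integrable S (\<lambda>x. f x * exp (x N))"
    and integral_past_exp: "(\<integral>x. f x * exp (x N) \<partial>S) = \<gamma> * (\<integral>x. f x \<partial>S)"
proof -
  have g: "integrable S (\<lambda>x. exp (x 0))"
    by (rule integrable_coordinate[of exp 0, THEN iffD2, OF _ integrable_exp]) measurable
  note facts = integrable_past_future[OF f g, of N, OF past] integral_past_future[OF f g, of N, OF past]
  show "integrable S (\<lambda>x. f x * exp (x N))"
    using facts(1) by (simp only: add_0)
  have "(\<integral>x. exp (x 0) \<partial>S) = \<gamma>"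
    unfolding \<gamma>_def by (rule integral_coordinate) measurable
  then show "(\<integral>x. f x * exp (x N) \<partial>S) = \<gamma> * (\<integral>x. f x \<partial>S)"
    using facts(2) by (simp only: add_0 mult.commute)
qed

lemma walk_exp_integral: "integrable S (walk_exp N) \<and> (\<integral>x. walk_exp N x \<partial>S) = \<gamma> ^ N"
proof (induction N)
  case (Suc N)
  have "walk_exp (Suc N) = (\<lambda>x. walk_exp N x * exp (x N))"
    by (simp add: fun_eq_iff walk_exp_Suc)
  moreover have "integrable S (\<lambda>x. walk_exp N x * exp (x N))"
    using Suc by (intro integrable_past_exp walk_exp_cong) auto
  moreover have "(\<integral>x. walk_exp N x * exp (x N) \<partial>S) = \<gamma> * (\<integral>x. walk_exp N x \<partial>S)"
    using Suc by (intro integral_past_exp walk_exp_cong) auto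
  ultimately show ?case using Suc by simp
qed (simp add: walk_exp_def P.prob_space)

lemmas integrable_walk_exp [simp] = walk_exp_integral[THEN conjunct1]
lemmas integral_walk_exp [simp] = walk_exp_integral[THEN conjunct2]

lemma integrable_walk_sum [simp]: "integrable S (walk_sum N)"
  unfolding walk_sum_def[abs_def] by simp

lemma integral_walk_sum_le: "(\<integral>x. walk_sum N x \<partial>S) \<le> 1 / (1 - \<gamma>)"
proof -
  have "(\<integral>x. walk_sum N x \<partial>S) = (\<Sum>k<N. \<gamma> ^ k)"
    unfolding walk_sum_def[abs_def] by simp
  also have "\<dots> \<le> (\<Sum>k. \<gamma> ^ k)"
    using \<gamma>_pos \<gamma>_less_1 by (intro sum_le_suminf) auto
  also have "\<dots> = 1 / (1 - \<gamma>)"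
    using \<gamma>_pos \<gamma>_less_1 by (simp add: suminf_geometric)
  finally show ?thesis .
qed

lemma integrable_walk_exp_bounded:
  assumes [measurable]: "f \<in> borel_measurable S" and "\<And>x. \<bar>f x\<bar> \<le> c"
  shows "integrable S (\<lambda>x. walk_exp N x * f x)"
proof (rule Bochner_Integration.integrable_bound)
  show "integrable S (\<lambda>x. walk_exp N x * c)" by simp
  show "AE x in S. norm (walk_exp N x * f x) \<le> norm (walk_exp N x * c)"
  proof (rule AE_I2)
    fix x
    have "\<bar>f x\<bar> \<le> \<bar>c\<bar>" using assms(2)[of x] by linarith
    then show "norm (walk_exp N x * f x) \<le> norm (walk_exp N x * c)"
      by (simp add: abs_mult mult_left_mono)
  qed
qed measurable

lemma bounded_inverse_walk_sum:
  "\<bar>inverse (walk_sum (Suc N) x)\<bar> \<le> 1" "\<bar>inverse (walk_sum (Suc N) x) ^ 2\<bar> \<le> 1"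
proof -
  have "0 \<le> inverse (walk_sum (Suc N) x)" "inverse (walk_sum (Suc N) x) \<le> 1"
    using walk_sum_ge_1[of N x] by (simp_all add: inverse_le_1_iff)
  then show "\<bar>inverse (walk_sum (Suc N) x)\<bar> \<le> 1" "\<bar>inverse (walk_sum (Suc N) x) ^ 2\<bar> \<le> 1"
    by (simp_all only: abs_of_nonneg power_le_one zero_le_power)
qed

definition tilted_inverse :: "nat \<Rightarrow> real" where
  "tilted_inverse N = (\<integral>x. walk_exp N x * inverse (walk_sum N x) \<partial>S) / \<gamma> ^ N"

definition tilted_inverse_square :: "nat \<Rightarrow> real" where
  "tilted_inverse_square N = (\<integral>x. walk_exp N x * inverse (walk_sum N x) ^ 2 \<partial>S) / \<gamma> ^ N"

lemma integrable_inverse [simp]: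
  "integrable S (\<lambda>x. walk_exp K x * inverse (walk_sum (Suc N) x))"
  "integrable S (\<lambda>x. walk_exp K x * inverse (walk_sum (Suc N) x) ^ 2)"
proof -
  have m: "(\<lambda>x. inverse (walk_sum (Suc N) x)) \<in> borel_measurable S"
    "(\<lambda>x. inverse (walk_sum (Suc N) x) ^ 2) \<in> borel_measurable S"
    by measurable
  show "integrable S (\<lambda>x. walk_exp K x * inverse (walk_sum (Suc N) x))"
    "integrable S (\<lambda>x. walk_exp K x * inverse (walk_sum (Suc N) x) ^ 2)"
    using integrable_walk_exp_bounded[OF m(1), of 1 K] integrable_walk_exp_bounded[OF m(2), of 1 K]
      bounded_inverse_walk_sum by metis+
qed

text \<open>The last increment is independent of \<open>walk_sum (Suc N)\<close>.\<close>
lemma integral_Suc_walk_exp: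
  assumes [measurable]: "f \<in> borel_measurable borel"
    and int: "integrable S (\<lambda>x. walk_exp N x * f (walk_sum (Suc N) x))"
  shows "integrable S (\<lambda>x. walk_exp (Suc N) x * f (walk_sum (Suc N) x))"
    and "(\<integral>x. walk_exp (Suc N) x * f (walk_sum (Suc N) x) \<partial>S) =
      \<gamma> * (\<integral>x. walk_exp N x * f (walk_sum (Suc N) x) \<partial>S)"
proof -
  let ?f = "\<lambda>x. walk_exp N x * f (walk_sum (Suc N) x)"
  have past: "?f x = ?f y" if "\<And>l. l < N \<Longrightarrow> x l = y l" for x y
    using that walk_exp_cong[of N x y] walk_sum_cong[of "Suc N" x y] by simp
  have *: "walk_exp (Suc N) x * f (walk_sum (Suc N) x) = ?f x * exp (x N)" for x
    by (simp add: walk_exp_Suc)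
  show "integrable S (\<lambda>x. walk_exp (Suc N) x * f (walk_sum (Suc N) x))"
    and "(\<integral>x. walk_exp (Suc N) x * f (walk_sum (Suc N) x) \<partial>S) = \<gamma> * (\<integral>x. ?f x \<partial>S)"
    unfolding * by (rule integrable_past_exp[OF int] integral_past_exp[OF int], rule past, simp)+
qed

lemma tilted_inverse_Suc:
  "tilted_inverse (Suc N) = (\<integral>x. walk_exp N x * inverse (walk_sum (Suc N) x) \<partial>S) / \<gamma> ^ N"
  using integral_Suc_walk_exp(2)[of inverse N] \<gamma>_pos by (simp add: tilted_inverse_def)

lemma tilted_inverse_square_Suc:
  "tilted_inverse_square (Suc N) = (\<integral>x. walk_exp N x * inverse (walk_sum (Suc N) x) ^ 2 \<partial>S) / \<gamma> ^ N"
  using integral_Suc_walk_exp(2)[of "\<lambda>a. inverse a ^ 2" N] \<gamma>_pos by (simp add: tilted_inverse_square_def)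

lemma decseq_tilted_inverse: "decseq (\<lambda>N. tilted_inverse (Suc N))"
proof (rule decseq_SucI)
  fix N
  have "(\<integral>x. walk_exp (Suc N) x * inverse (walk_sum (Suc (Suc N)) x) \<partial>S)
      \<le> (\<integral>x. walk_exp (Suc N) x * inverse (walk_sum (Suc N) x) \<partial>S)"
    by (intro integral_mono mult_left_mono le_imp_inverse_le walk_sum_mono walk_sum_pos) simp_all
  then show "tilted_inverse (Suc (Suc N)) \<le> tilted_inverse (Suc N)"
    using \<gamma>_pos unfolding tilted_inverse_Suc[of "Suc N"] tilted_inverse_def[of "Suc N"]
    by (intro divide_right_mono) auto
qed

lemma decseq_tilted_inverse_square: "decseq (\<lambda>N. tilted_inverse_square (Suc N))"
proof (rule decseq_SucI)
  fix N
  have "(\<integral>x. walk_exp (Suc N) x * inverse (walk_sum (Suc (Suc N)) x) ^ 2 \<partial>S)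
      \<le> (\<integral>x. walk_exp (Suc N) x * inverse (walk_sum (Suc N) x) ^ 2 \<partial>S)"
    using walk_sum_ge_1
    by (intro integral_mono mult_left_mono power_mono le_imp_inverse_le walk_sum_mono walk_sum_pos)
       (simp_all add: walk_sum_pos less_imp_le)
  then show "tilted_inverse_square (Suc (Suc N)) \<le> tilted_inverse_square (Suc N)"
    using \<gamma>_pos unfolding tilted_inverse_square_Suc[of "Suc N"] tilted_inverse_square_def[of "Suc N"]
    by (intro divide_right_mono) auto
qed

lemma
  fixes f :: "real \<Rightarrow> real"
  assumes [measurable]: "f \<in> borel_measurable borel" and "integrable Q f" and "integrable S g"
  shows integrable_first_rest: "integrable S (\<lambda>x. f (x 0) * g (\<lambda>l. x (l + 1)))"
    and integral_first_rest:
      "(\<integral>x. f (x 0) * g (\<lambda>l. x (l + 1)) \<partial>S) = (\<integral>x. f x \<partial>Q) * (\<integral>x. g x \<partial>S)"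
proof -
  have f: "integrable S (\<lambda>x. f (x 0))"
    by (rule integrable_coordinate[THEN iffD2, OF assms(1,2)])
  show "integrable S (\<lambda>x. f (x 0) * g (\<lambda>l. x (l + 1)))"
    by (rule integrable_past_future[OF f assms(3)]) simp
  have "(\<integral>x. f (x 0) * g (\<lambda>l. x (l + 1)) \<partial>S) = (\<integral>x. f (x 0) \<partial>S) * (\<integral>x. g x \<partial>S)"
    by (rule integral_past_future[OF f assms(3)]) simp
  then show "(\<integral>x. f (x 0) * g (\<lambda>l. x (l + 1)) \<partial>S) = (\<integral>x. f x \<partial>Q) * (\<integral>x. g x \<partial>S)"
    by (simp only: integral_coordinate[OF assms(1)])
qed

lemma ln_walk_sum_shift:
  "ln (walk_sum (Suc (Suc N)) x) = x 0 + ln (walk_sum (Suc N) (\<lambda>l. x (l + 1)))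
     + ln (1 + exp (- x 0) * inverse (walk_sum (Suc N) (\<lambda>l. x (l + 1))))"
proof -
  define a where "a = walk_sum (Suc N) (\<lambda>l. x (l + 1))"
  have a: "a > 0" unfolding a_def by (rule walk_sum_pos) simp
  have "1 + exp (x 0) * a = exp (x 0) * a * (1 + exp (- x 0) * inverse a)"
    using a by (simp add: field_simps exp_minus)
  moreover have "0 < 1 + exp (- x 0) * inverse a" using a by (simp add: add_pos_pos)
  ultimately show ?thesis
    using a unfolding walk_sum_shift[of "Suc N"] a_def[symmetric] by (simp add: ln_mult)
qed

lemma walk_exp_ln_correction:
  "walk_exp (Suc (Suc N)) x * ln (1 + exp (- x 0) * inverse (walk_sum (Suc N) (\<lambda>l. x (l + 1))))
     \<in> {0..walk_exp (Suc N) (\<lambda>l. x (l + 1)) * inverse (walk_sum (Suc N) (\<lambda>l. x (l + 1)))}"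
proof -
  define a where "a = walk_sum (Suc N) (\<lambda>l. x (l + 1))"
  define w where "w = walk_exp (Suc N) (\<lambda>l. x (l + 1))"
  have a: "a > 0" unfolding a_def by (rule walk_sum_pos) simp
  have w: "w > 0" by (simp add: w_def)
  have "ln (1 + exp (- x 0) * inverse a) \<le> exp (- x 0) * inverse a"
    using a by (intro ln_add_one_self_le_self) auto
  then have "exp (x 0) * w * ln (1 + exp (- x 0) * inverse a) \<le> exp (x 0) * w * (exp (- x 0) * inverse a)"
    using w by (intro mult_left_mono) auto
  also have "\<dots> = w * inverse a" by (simp add: exp_minus)
  finally show ?thesis
    using a w unfolding walk_exp_shift[of "Suc N"] a_def[symmetric] w_def[symmetric] by simp
qed

lemma integrable_walk_exp_ln_sum: "integrable S (\<lambda>x. walk_exp (Suc N) x * ln (walk_sum (Suc N) x))"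
proof (induction N)
  case 0
  then show ?case by (simp add: walk_sum_Suc)
next
  case (Suc N)
  let ?s = "\<lambda>x::nat \<Rightarrow> real. \<lambda>l. x (l + 1)"
  let ?c = "\<lambda>x. walk_exp (Suc (Suc N)) x * ln (1 + exp (- x 0) * inverse (walk_sum (Suc N) (?s x)))"
  note shift_measurable [measurable]
  have c: "integrable S ?c"
  proof (rule Bochner_Integration.integrable_bound)
    show "integrable S (\<lambda>x. 1 * (walk_exp (Suc N) (?s x) * inverse (walk_sum (Suc N) (?s x))))"
      by (rule integrable_first_rest[where f = "\<lambda>_. 1"]) auto
    show "AE x in S. norm (?c x) \<le> norm (1 * (walk_exp (Suc N) (?s x) * inverse (walk_sum (Suc N) (?s x))))"
    proof (rule AE_I2)
      fix x
      show "norm (?c x) \<le> norm (1 * (walk_exp (Suc N) (?s x) * inverse (walk_sum (Suc N) (?s x))))"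
        using walk_exp_ln_correction[of N x] unfolding atLeastAtMost_iff real_norm_def by linarith
    qed
  qed measurable
  have "integrable S (\<lambda>x. (x 0 * exp (x 0)) * walk_exp (Suc N) (?s x)
      + exp (x 0) * (walk_exp (Suc N) (?s x) * ln (walk_sum (Suc N) (?s x))) + ?c x)"
    by (intro Bochner_Integration.integrable_add c
        integrable_first_rest[of "\<lambda>x. x * exp x", OF _ integrable_tilted integrable_walk_exp]
        integrable_first_rest[of exp, OF _ integrable_exp Suc]) measurable
  moreover have "walk_exp (Suc (Suc N)) x * ln (walk_sum (Suc (Suc N)) x) =
     (x 0 * exp (x 0)) * walk_exp (Suc N) (?s x)
      + exp (x 0) * (walk_exp (Suc N) (?s x) * ln (walk_sum (Suc N) (?s x))) + ?c x" for x
    unfolding ln_walk_sum_shift walk_exp_shift[of "Suc N"] by (simp only: algebra_simps)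
  ultimately show ?case by presburger
qed


lemma tilted_inverse_ge: "tilted_inverse (Suc N) \<ge> - (\<integral>x. x * exp x \<partial>Q)"
proof -
  let ?s = "\<lambda>x::nat \<Rightarrow> real. \<lambda>l. x (l + 1)"
  let ?L = "\<integral>x. walk_exp (Suc N) x * ln (walk_sum (Suc N) x) \<partial>S"
  let ?I = "\<integral>x. walk_exp (Suc N) x * inverse (walk_sum (Suc N) x) \<partial>S"
  let ?d = "\<integral>x. x * exp x \<partial>Q"
  let ?f = "\<lambda>x. (x 0 * exp (x 0)) * walk_exp (Suc N) (?s x)
      + exp (x 0) * (walk_exp (Suc N) (?s x) * ln (walk_sum (Suc N) (?s x)))
      + 1 * (walk_exp (Suc N) (?s x) * inverse (walk_sum (Suc N) (?s x)))"
  note int1 = integrable_first_rest[of "\<lambda>x. x * exp x" "walk_exp (Suc N)"]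
  note int2 = integrable_first_rest[of exp "\<lambda>x. walk_exp (Suc N) x * ln (walk_sum (Suc N) x)"]
  note int3 = integrable_first_rest[of "\<lambda>_. 1" "\<lambda>x. walk_exp (Suc N) x * inverse (walk_sum (Suc N) x)"]
  note ints = int1[OF _ integrable_tilted integrable_walk_exp]
    int2[OF _ integrable_exp integrable_walk_exp_ln_sum] int3[OF _ _ integrable_inverse(1)]
  have m: "(\<lambda>x::real. x * exp x) \<in> borel_measurable borel" "(exp :: real \<Rightarrow> real) \<in> borel_measurable borel"
    by measurable
  have "\<gamma> * ?L = (\<integral>x. (walk_exp (Suc N) x * ln (walk_sum (Suc N) x)) * exp (x (Suc N)) \<partial>S)"
    by (rule integral_past_exp[OF integrable_walk_exp_ln_sum, symmetric])
       (auto intro!: arg_cong2[where f = "(*)"] arg_cong[where f = ln] walk_exp_cong walk_sum_cong)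
  also have "\<dots> \<le> (\<integral>x. walk_exp (Suc (Suc N)) x * ln (walk_sum (Suc (Suc N)) x) \<partial>S)"
  proof (rule integral_mono)
    show "integrable S (\<lambda>x. (walk_exp (Suc N) x * ln (walk_sum (Suc N) x)) * exp (x (Suc N)))"
      by (rule integrable_past_exp[OF integrable_walk_exp_ln_sum])
         (auto intro!: arg_cong2[where f = "(*)"] arg_cong[where f = ln] walk_exp_cong walk_sum_cong)
    show "walk_exp (Suc N) x * ln (walk_sum (Suc N) x) * exp (x (Suc N))
        \<le> walk_exp (Suc (Suc N)) x * ln (walk_sum (Suc (Suc N)) x)" for x
    proof -
      have "ln (walk_sum (Suc N) x) \<le> ln (walk_sum (Suc (Suc N)) x)"
        by (simp add: walk_sum_pos walk_sum_mono)
      then have "walk_exp (Suc (Suc N)) x * ln (walk_sum (Suc N) x)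
          \<le> walk_exp (Suc (Suc N)) x * ln (walk_sum (Suc (Suc N)) x)"
        by (intro mult_left_mono) simp_all
      then show ?thesis by (simp add: walk_exp_Suc[of "Suc N"] mult_ac)
    qed
  qed (rule integrable_walk_exp_ln_sum)
  also have "\<dots> \<le> (\<integral>x. ?f x \<partial>S)"
  proof (rule integral_mono)
    show "integrable S ?f"
      by (intro Bochner_Integration.integrable_add ints m) auto
    show "walk_exp (Suc (Suc N)) x * ln (walk_sum (Suc (Suc N)) x) \<le> ?f x" for x
    proof -
      have "walk_exp (Suc (Suc N)) x * ln (walk_sum (Suc (Suc N)) x)
          = (x 0 * exp (x 0)) * walk_exp (Suc N) (?s x)
          + exp (x 0) * (walk_exp (Suc N) (?s x) * ln (walk_sum (Suc N) (?s x)))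
          + walk_exp (Suc (Suc N)) x * ln (1 + exp (- x 0) * inverse (walk_sum (Suc N) (?s x)))"
        unfolding ln_walk_sum_shift walk_exp_shift[of "Suc N"] by (simp only: algebra_simps)
      then show ?thesis
        using walk_exp_ln_correction[of N x] unfolding atLeastAtMost_iff by linarith
    qed
  qed (rule integrable_walk_exp_ln_sum)
  also have "\<dots> = ?d * \<gamma> ^ Suc N + \<gamma> * ?L + ?I"
  proof -
    have "(\<integral>x. (x 0 * exp (x 0)) * walk_exp (Suc N) (?s x) \<partial>S) = ?d * \<gamma> ^ Suc N"
      using integral_first_rest[OF m(1) integrable_tilted integrable_walk_exp[of "Suc N"]]
      by (simp only: integral_walk_exp)
    moreover have "(\<integral>x. exp (x 0) * (walk_exp (Suc N) (?s x) * ln (walk_sum (Suc N) (?s x))) \<partial>S) = \<gamma> * ?L"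
      using integral_first_rest[OF m(2) integrable_exp integrable_walk_exp_ln_sum[of N]]
      by (simp only: \<gamma>_def)
    moreover have "(\<integral>x. 1 * (walk_exp (Suc N) (?s x) * inverse (walk_sum (Suc N) (?s x))) \<partial>S) = 1 * ?I"
      using integral_first_rest[of "\<lambda>_. 1", OF borel_measurable_const M.integrable_const
          integrable_inverse(1)[of "Suc N" N]] M.prob_space
      by (simp only: Bochner_Integration.lebesgue_integral_const scaleR_one mult_1)
    moreover have "(\<integral>x. ?f x \<partial>S) = (\<integral>x. (x 0 * exp (x 0)) * walk_exp (Suc N) (?s x) \<partial>S)
      + (\<integral>x. exp (x 0) * (walk_exp (Suc N) (?s x) * ln (walk_sum (Suc N) (?s x))) \<partial>S)
      + (\<integral>x. 1 * (walk_exp (Suc N) (?s x) * inverse (walk_sum (Suc N) (?s x))) \<partial>S)"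
      by (intro Bochner_Integration.integral_add[THEN trans] Bochner_Integration.integrable_add ints m
          arg_cong2[where f = "(+)"] refl) auto
    ultimately show ?thesis by (simp only: mult_1)
  qed
  finally have "- ?d * \<gamma> ^ Suc N \<le> ?I" by simp
  then show ?thesis
    using \<gamma>_pos unfolding tilted_inverse_def by (subst pos_le_divide_eq) auto
qed

lemma tilted_inverse_power2_le: "tilted_inverse (Suc N) ^ 2 \<le> tilted_inverse_square (Suc N)"
proof -
  define a where "a = tilted_inverse (Suc N)"
  let ?i = "\<lambda>x. inverse (walk_sum (Suc N) x)"
  have "0 \<le> (\<integral>x. walk_exp (Suc N) x * (?i x - a) ^ 2 \<partial>S)"
    by (intro Bochner_Integration.integral_nonneg) simp
  also have "\<dots> = (\<integral>x. walk_exp (Suc N) x * ?i x ^ 2 - (2 * a) * (walk_exp (Suc N) x * ?i x)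
      + a ^ 2 * walk_exp (Suc N) x \<partial>S)"
    by (intro Bochner_Integration.integral_cong refl) (simp add: algebra_simps power2_eq_square)
  also have "\<dots> = (\<integral>x. walk_exp (Suc N) x * ?i x ^ 2 \<partial>S) - (2 * a) * (\<integral>x. walk_exp (Suc N) x * ?i x \<partial>S)
      + a ^ 2 * \<gamma> ^ Suc N"
    using integrable_inverse[of "Suc N" N] integrable_walk_exp[of "Suc N"] integral_walk_exp[of "Suc N"]
    by (simp del: power_Suc)
  also have "\<dots> = \<gamma> ^ Suc N * (tilted_inverse_square (Suc N) - a ^ 2)"
    using \<gamma>_pos unfolding a_def tilted_inverse_def tilted_inverse_square_def
    by (simp add: field_simps power2_eq_square)
  finally show ?thesis
    using zero_less_power[OF \<gamma>_pos, of "Suc N"] unfolding zero_le_mult_iff a_def by linarith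
qed

definition clan_prob :: "nat \<Rightarrow> nat \<Rightarrow> real" where
  "clan_prob N n = (\<integral>x. walk_exp N x * (inverse (walk_sum N x) * inverse (walk_sum (Suc n) x)) \<partial>S)"

lemma integrable_clan_prob:
  "integrable S (\<lambda>x. walk_exp K x * (inverse (walk_sum (Suc N) x) * inverse (walk_sum (Suc n) x)))"
proof (rule integrable_walk_exp_bounded)
  show "\<bar>inverse (walk_sum (Suc N) x) * inverse (walk_sum (Suc n) x)\<bar> \<le> 1" for x
    unfolding abs_mult using bounded_inverse_walk_sum(1)[of N x] bounded_inverse_walk_sum(1)[of n x]
    by (intro mult_le_one) auto
qed measurable

lemma clan_prob_upper:
  assumes "Suc N \<le> n"
  shows "clan_prob (Suc N) n / \<gamma> ^ Suc N \<le> tilted_inverse_square (Suc N)"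
proof -
  have "inverse (walk_sum (Suc n) x) \<le> inverse (walk_sum (Suc N) x)" for x
    using assms by (intro le_imp_inverse_le walk_sum_mono walk_sum_pos) auto
  then have "clan_prob (Suc N) n \<le> (\<integral>x. walk_exp (Suc N) x * inverse (walk_sum (Suc N) x) ^ 2 \<partial>S)"
    unfolding clan_prob_def power2_eq_square
    using walk_sum_pos[of "Suc N"] integrable_inverse(2)[of "Suc N" N]
    by (intro integral_mono integrable_clan_prob mult_left_mono)
       (simp_all add: power2_eq_square less_imp_le)
  then show ?thesis
    using \<gamma>_pos unfolding tilted_inverse_square_def by (intro divide_right_mono) simp_all
qed

text \<open>
  With \<open>A\<close> and \<open>W\<close> the sum and the exponential of the walk at time \<open>Suc N\<close>, the defect
  \<open>W / A\<^sup>2 - W / (A * (A + W * D))\<close> is at most \<open>D * (W / A - W / (A + W))\<close> for \<open>D \<ge> 1\<close>, which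
  telescopes under the tilted expectation.
\<close>
lemma clan_prob_lower:
  assumes "Suc N \<le> n"
  shows "tilted_inverse_square (Suc N)
      - (tilted_inverse (Suc N) - tilted_inverse (Suc (Suc N))) / (1 - \<gamma>)
    \<le> clan_prob (Suc N) n / \<gamma> ^ Suc N"
proof -
  obtain K where n: "n = Suc N + K" using assms le_Suc_ex by blast
  let ?W = "walk_exp (Suc N)" and ?A = "walk_sum (Suc N)" and ?B = "walk_sum (Suc (Suc N))"
  let ?D = "\<lambda>x. walk_sum (Suc K) (\<lambda>l. x (l + Suc N))"
  let ?g = "\<lambda>x. ?W x * inverse (?A x) - ?W x * inverse (?B x)"
  have g: "integrable S ?g" by (intro Bochner_Integration.integrable_diff integrable_inverse)
  have past: "?g x = ?g y" if "\<And>l. l < Suc N \<Longrightarrow> x l = y l" for x y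
    using that walk_exp_cong[of "Suc N" x y] walk_sum_cong[of "Suc N" x y] walk_sum_cong[of "Suc (Suc N)" x y]
    by simp
  have gD: "integrable S (\<lambda>x. ?g x * ?D x)" "(\<integral>x. ?g x * ?D x \<partial>S) = (\<integral>x. ?g x \<partial>S) * (\<integral>x. walk_sum (Suc K) x \<partial>S)"
    by (rule integrable_past_future[OF g integrable_walk_sum], rule past, simp)
       (rule integral_past_future[OF g integrable_walk_sum], rule past, simp)
  have nonneg: "0 \<le> ?g x" for x
    using walk_sum_mono[of "Suc N" "Suc (Suc N)" x] walk_sum_pos[of "Suc N" x]
    by (simp add: mult_left_mono le_imp_inverse_le)
  have pointwise: "?W x * inverse (?A x) ^ 2 - ?g x * ?D x
      \<le> ?W x * (inverse (?A x) * inverse (walk_sum (Suc n) x))" for x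
  proof -
    define w a d where "w = ?W x" and "a = ?A x" and "d = ?D x"
    have w: "w > 0" and a: "a \<ge> 1" and d: "d \<ge> 1"
      by (simp_all add: w_def a_def d_def walk_sum_ge_1)
    have B: "?B x = a + w" by (simp add: a_def w_def walk_sum_Suc[of "Suc N"])
    have C: "walk_sum (Suc n) x = a + w * d"
      using walk_sum_add[of "Suc N" "Suc K" x] by (simp add: n a_def w_def d_def)
    have pos: "0 < a" "0 < a + w" "0 < a + w * d" using w a d by (simp_all add: add_pos_pos)
    have "w * inverse a ^ 2 - w * (inverse a * inverse (a + w * d)) = w * w * d / (a * a * (a + w * d))"
      using pos by (simp add: divide_simps power2_eq_square) (simp add: algebra_simps)?
    also have "\<dots> \<le> w * w * d / (1 * a * (a + w * 1))"
      using w a d by (intro divide_left_mono mult_mono add_mono mult_pos_pos) (auto intro: add_pos_pos)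
    also have "\<dots> = (w * inverse a - w * inverse (a + w)) * d"
      using pos by (simp add: field_simps)
    finally show ?thesis
      unfolding B C w_def[symmetric] a_def[symmetric] d_def[symmetric] by linarith
  qed
  have I: "(\<integral>x. ?g x \<partial>S) = \<gamma> ^ Suc N * (tilted_inverse (Suc N) - tilted_inverse (Suc (Suc N)))"
    using \<gamma>_pos unfolding tilted_inverse_Suc[of "Suc N"] tilted_inverse_def[of "Suc N"]
    by (subst Bochner_Integration.integral_diff) (simp_all add: right_diff_distrib)
  have "\<gamma> ^ Suc N * tilted_inverse_square (Suc N) - (\<integral>x. ?g x \<partial>S) * (1 / (1 - \<gamma>))
      \<le> \<gamma> ^ Suc N * tilted_inverse_square (Suc N) - (\<integral>x. ?g x \<partial>S) * (\<integral>x. walk_sum (Suc K) x \<partial>S)"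
    using nonneg by (intro diff_left_mono mult_left_mono integral_walk_sum_le Bochner_Integration.integral_nonneg) simp_all
  also have "\<dots> = (\<integral>x. ?W x * inverse (?A x) ^ 2 - ?g x * ?D x \<partial>S)"
    using gD \<gamma>_pos integrable_inverse(2)[of "Suc N" N]
    by (subst Bochner_Integration.integral_diff) (simp_all add: tilted_inverse_square_def)
  also have "\<dots> \<le> clan_prob (Suc N) n"
    unfolding clan_prob_def using pointwise
    by (intro integral_mono Bochner_Integration.integrable_diff gD integrable_inverse integrable_clan_prob)
  finally show ?thesis
    using \<gamma>_pos unfolding I by (subst pos_le_divide_eq) (simp_all add: algebra_simps diff_divide_distrib)
qed

lemma tilted_limit:
  obtains R where "R > 0" "tilted_inverse_square \<longlonglongrightarrow> R"
    "(\<lambda>N. tilted_inverse_square N - (tilted_inverse N - tilted_inverse (Suc N)) / (1 - \<gamma>)) \<longlonglongrightarrow> R"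
proof -
  let ?d = "- (\<integral>x. x * exp x \<partial>Q)"
  have sq: "?d ^ 2 \<le> tilted_inverse_square (Suc N)" for N
    using power_mono[OF tilted_inverse_ge[of N], of 2] tilted_inverse_power2_le[of N] tilted_drift by simp
  obtain R where R: "(\<lambda>N. tilted_inverse_square (Suc N)) \<longlonglongrightarrow> R" "\<And>N. R \<le> tilted_inverse_square (Suc N)"
    using decseq_convergent[OF decseq_tilted_inverse_square, of "?d ^ 2"] sq by blast
  obtain a where a: "(\<lambda>N. tilted_inverse (Suc N)) \<longlonglongrightarrow> a"
    using decseq_convergent[OF decseq_tilted_inverse, of ?d] tilted_inverse_ge by blast
  have a0: "tilted_inverse \<longlonglongrightarrow> a" and R0: "tilted_inverse_square \<longlonglongrightarrow> R"
    using a R(1) by (simp_all add: filterlim_sequentially_Suc)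
  have "(\<lambda>N. tilted_inverse_square N - (tilted_inverse N - tilted_inverse (Suc N)) / (1 - \<gamma>))
      \<longlonglongrightarrow> R - (a - a) / (1 - \<gamma>)"
    using \<gamma>_less_1 by (intro tendsto_intros a a0 R0) simp
  moreover have "R \<ge> ?d ^ 2" using R(1) by (rule LIMSEQ_le_const) (use sq in blast)
  moreover have "?d ^ 2 > 0" using tilted_drift by simp
  ultimately show ?thesis
    using R0 that[of R] by (simp only: diff_self div_0 diff_zero)
qed

lemma clan_prob_limit_fixed:
  assumes "N > 0"
  obtains r where "r > 0" "clan_prob N \<longlonglongrightarrow> r"
proof -
  obtain N' where N: "N = Suc N'" using assms gr0_implies_Suc by blast
  have "decseq (clan_prob N)"
  proof (rule decseq_SucI)
    fix n
    show "clan_prob N (Suc n) \<le> clan_prob N n"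
      unfolding clan_prob_def N
      by (intro integral_mono integrable_clan_prob mult_left_mono le_imp_inverse_le walk_sum_mono walk_sum_pos)
         (simp_all add: walk_sum_pos less_imp_le)
  qed
  let ?z = "\<lambda>x. sqrt (walk_exp N x * inverse (walk_sum N x))"
  have zpos: "walk_exp N x * inverse (walk_sum N x) > 0" for x
    using walk_sum_pos[of N x] assms by simp
  have z: "integrable S ?z"
  proof (rule Bochner_Integration.integrable_bound)
    show "integrable S (\<lambda>x. 1 + walk_exp N x * inverse (walk_sum N x))"
      unfolding N by (intro Bochner_Integration.integrable_add integrable_inverse) simp
    have "sqrt y \<le> 1 + y" if "y > 0" for y :: real
      using that by (intro real_le_lsqrt) (auto simp: power2_eq_square algebra_simps)
    then show "AE x in S. norm (?z x) \<le> norm (1 + walk_exp N x * inverse (walk_sum N x))"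
      using zpos by (intro AE_I2) (simp add: less_imp_le add_pos_pos)
  qed measurable
  define c where "c = (\<integral>x. ?z x \<partial>S)"
  have c: "c > 0"
    unfolding c_def using z zpos P.integral_less_AE_space[of "\<lambda>_. 0" ?z]
    by (simp add: P.emeasure_space_1)
  define t where "t = (1 - \<gamma>) * c"
  have t: "t > 0" using c \<gamma>_less_1 by (simp add: t_def)
  have bound: "t * c \<le> clan_prob N n" for n
  proof -
    \<comment> \<open>\<open>2 t sqrt z \<le> z / A + t\<^sup>2 A\<close>\<close>
    have pointwise: "2 * t * ?z x - t ^ 2 * walk_sum (Suc n) x
        \<le> walk_exp N x * (inverse (walk_sum N x) * inverse (walk_sum (Suc n) x))" for x
    proof -
      define y a where "y = ?z x" and "a = walk_sum (Suc n) x"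
      have a: "a > 0" unfolding a_def by (rule walk_sum_pos) simp
      have y: "y * y = walk_exp N x * inverse (walk_sum N x)"
        using zpos[of x] by (simp add: y_def)
      have "0 \<le> (y - t * a) ^ 2 / a" using a by simp
      also have "\<dots> = y * y * inverse a - (2 * t * y - t ^ 2 * a)"
        using a by (simp add: field_simps power2_eq_square)
      finally have "2 * t * y - t ^ 2 * a \<le> y * y * inverse a" by linarith
      then show ?thesis unfolding y by (simp add: y_def a_def mult.assoc)
    qed
    have "t ^ 2 * (\<integral>x. walk_sum (Suc n) x \<partial>S) \<le> t ^ 2 * (1 / (1 - \<gamma>))"
      by (intro mult_left_mono integral_walk_sum_le) simp
    also have "\<dots> = t * c" using \<gamma>_less_1 by (simp add: t_def power2_eq_square)
    finally have "t * c \<le> 2 * t * c - t ^ 2 * (\<integral>x. walk_sum (Suc n) x \<partial>S)" by linarith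
    also have "\<dots> = (\<integral>x. 2 * t * ?z x - t ^ 2 * walk_sum (Suc n) x \<partial>S)"
      using z by (subst Bochner_Integration.integral_diff) (simp_all add: c_def)
    also have "\<dots> \<le> clan_prob N n"
      unfolding clan_prob_def using pointwise z integrable_clan_prob[of N N' n, folded N]
      by (intro integral_mono) simp_all
    finally show ?thesis .
  qed
  obtain r where "clan_prob N \<longlonglongrightarrow> r"
    using decseq_convergent[OF \<open>decseq (clan_prob N)\<close>, of "t * c"] bound by blast
  moreover have "r \<ge> t * c" using calculation by (rule LIMSEQ_le_const) (use bound in blast)
  moreover have "t * c > 0" using t c by simp
  ultimately show ?thesis using that[of r] by simp
qed

end

section \<open>Geometric laws\<close>

lemma pmf_diff_le_tv_dist: "\<bar>pmf f j - pmf g j\<bar> \<le> tv_dist f g"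
proof -
  have "\<bar>measure_pmf.prob f A - measure_pmf.prob g A\<bar> \<le> 1" for A
    using measure_pmf.prob_le_1[of f A] measure_pmf.prob_le_1[of g A]
      measure_nonneg[of "measure_pmf f" A] measure_nonneg[of "measure_pmf g" A] by linarith
  then have "bdd_above (range (\<lambda>A. \<bar>measure_pmf.prob f A - measure_pmf.prob g A\<bar>))"
    by (intro bdd_aboveI[of _ 1]) auto
  then show ?thesis
    unfolding tv_dist_def by (rule cSUP_upper2[of _ _ "{j}"]) (simp_all add: measure_pmf_single)
qed

lemma space_pmf_borel [simp]: "space pmf_borel = UNIV"
  by (simp add: pmf_borel_def)

lemma borel_measurable_pmf [measurable]: "(\<lambda>f. pmf f j) \<in> borel_measurable pmf_borel"
  unfolding borel_measurable_iff_greater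
proof
  fix a
  have "\<exists>e>0. \<forall>g. tv_dist f g < e \<longrightarrow> a < pmf g j" if "a < pmf f j" for f
  proof (intro exI[of _ "pmf f j - a"] conjI allI impI)
    fix g assume "tv_dist f g < pmf f j - a"
    then show "a < pmf g j" using pmf_diff_le_tv_dist[of f j g] by linarith
  qed (use that in simp)
  then have "{f. a < pmf f j} \<in> {U. \<forall>f\<in>U. \<exists>e>0. \<forall>g. tv_dist f g < e \<longrightarrow> g \<in> U}"
    by simp
  then show "{f \<in> space pmf_borel. a < pmf f j} \<in> sets pmf_borel"
    unfolding space_pmf_borel pmf_borel_def by (simp add: sets_measure_of)
qed

lemma borel_measurable_gen_fun [measurable (raw)]:
  assumes [measurable]: "f \<in> N \<rightarrow>\<^sub>M pmf_borel" "s \<in> borel_measurable N"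
  shows "(\<lambda>\<omega>. gen_fun (f \<omega>) (s \<omega>)) \<in> borel_measurable N"
  unfolding gen_fun_def by measurable

lemma borel_measurable_offspring_mean [measurable]: "offspring_mean \<in> borel_measurable pmf_borel"
  unfolding offspring_mean_def[abs_def] by measurable

lemma pmf_nat_sums: "(\<lambda>j. pmf f j) sums 1" for f :: "nat pmf"
proof -
  have "(\<lambda>j. measure_pmf.prob f {j}) sums measure_pmf.prob f (\<Union>j. {j})"
    by (intro measure_pmf.finite_measure_UNION) (auto simp: disjoint_family_on_def)
  moreover have "(\<Union>j::nat. {j}) = UNIV" by auto
  ultimately show ?thesis by (simp add: measure_pmf_single)
qed

lemma gen_fun_sums:
  assumes "0 \<le> s" "s \<le> 1"
  shows "(\<lambda>j. pmf f j * s ^ j) sums gen_fun f s"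
  unfolding gen_fun_def
  by (intro summable_sums summable_comparison_test[OF _ sums_summable[OF pmf_nat_sums[of f]]])
     (use assms in \<open>auto intro!: exI[of _ 0] mult_left_le power_le_one simp: abs_mult power_abs\<close>)

lemma gen_fun_bounds:
  assumes "0 \<le> s" "s \<le> 1"
  shows "0 \<le> gen_fun f s" "gen_fun f s \<le> 1"
proof -
  show "0 \<le> gen_fun f s"
    by (rule sums_le[OF _ sums_zero gen_fun_sums[OF assms, of f]]) (use assms in simp)
  show "gen_fun f s \<le> 1"
    by (rule sums_le[OF _ gen_fun_sums[OF assms, of f] pmf_nat_sums[of f]])
       (use assms in \<open>auto intro!: mult_left_le power_le_one\<close>)
qed

lemma gen_fun_1 [simp]: "gen_fun f 1 = 1"
  using pmf_nat_sums[of f] by (simp add: gen_fun_def sums_iff)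

lemma geometric_law_pmf:
  assumes "geometric_law f"
  shows "0 < pmf f 0" "pmf f 0 < 1" "pmf f j = pmf f 0 * (1 - pmf f 0) ^ j"
proof -
  obtain p q where pq: "0 < p" "p < 1" "0 < q" "p + q = 1"
    and g: "\<And>s. 0 \<le> s \<Longrightarrow> s \<le> 1 \<Longrightarrow> gen_fun f s = q / (1 - p * s)"
    using assms unfolding geometric_law_def greaterThanLessThan_iff atLeastAtMost_iff Ball_def by metis
  have "gen_fun f 0 = pmf f 0" unfolding gen_fun_def by (subst suminf_finite[of "{0}"]) auto
  then have q: "pmf f 0 = q" using g[of 0] by simp
  let ?c = "\<lambda>j. pmf f j - q * p ^ j"
  define h where "h s = (\<Sum>j. ?c j * s ^ j)" for s :: real
  have geo: "(\<lambda>j. q * p ^ j * s ^ j) sums (q / (1 - p * s))" if "\<bar>s\<bar> < 1" for s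
  proof -
    have "\<bar>p * s\<bar> < 1 * 1" unfolding abs_mult using pq that by (intro mult_strict_mono) auto
    then have "(\<lambda>j. q * (p * s) ^ j) sums (q * (1 / (1 - p * s)))"
      by (intro sums_mult geometric_sums) simp
    then show ?thesis by (simp add: power_mult_distrib mult_ac)
  qed
  have sums: "(\<lambda>j. ?c j * s ^ j) sums h s" if "\<bar>s\<bar> < 1" for s
  proof -
    have "summable (\<lambda>j. pmf f j * s ^ j)"
      by (intro summable_comparison_test[OF _ sums_summable[OF pmf_nat_sums[of f]]])
         (use that in \<open>auto intro!: exI[of _ 0] mult_left_le power_le_one simp: abs_mult power_abs\<close>)
    then have "summable (\<lambda>j. pmf f j * s ^ j - q * p ^ j * s ^ j)"
      using geo[OF that] by (intro summable_diff) (auto simp: sums_iff)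
    then show ?thesis unfolding h_def by (intro summable_sums) (simp add: left_diff_distrib)
  qed
  have zero: "h s = 0" if "0 \<le> s" "s < 1" for s
  proof -
    have "(\<lambda>j. pmf f j * s ^ j - q * p ^ j * s ^ j) sums (gen_fun f s - q / (1 - p * s))"
      using that by (intro sums_diff gen_fun_sums geo) auto
    then have "(\<lambda>j. ?c j * s ^ j) sums 0"
      using g[of s] that by (simp add: left_diff_distrib)
    with sums[of s] that show ?thesis by (auto dest: sums_unique2)
  qed
  have "?c j = 0"
  proof (rule ccontr)
    assume nz: "?c j \<noteq> 0"
    then have "j > 0" using q by (cases j) auto
    have "\<And>s. norm (s - 0) < 1 \<Longrightarrow> (\<lambda>j. ?c j * (s - 0) ^ j) sums h s" using sums by simp
    then obtain r where r: "r > 0" "\<And>z. z \<in> cball 0 r - {0} \<Longrightarrow> h z \<noteq> 0"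
      using powser_0_nonzero[of 1 0 ?c h j] nz \<open>j > 0\<close> zero[of 0] by auto
    have "h (min r (1/2)) \<noteq> 0" using r(1) by (intro r(2)) (auto simp: dist_norm)
    moreover have "h (min r (1/2)) = 0" using r(1) by (intro zero) auto
    ultimately show False by simp
  qed
  moreover have "p = 1 - pmf f 0" using pq q by simp
  ultimately show "0 < pmf f 0" "pmf f 0 < 1" "pmf f j = pmf f 0 * (1 - pmf f 0) ^ j"
    using pq q by simp_all
qed

definition geometric_pmf_set :: "nat pmf set" where
  "geometric_pmf_set = {f. 0 < pmf f 0 \<and> pmf f 0 < 1 \<and> (\<forall>j. pmf f j = pmf f 0 * (1 - pmf f 0) ^ j)}"

lemma sets_geometric_pmf_set [measurable]: "geometric_pmf_set \<in> sets pmf_borel"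
proof -
  have "{f \<in> space pmf_borel. 0 < pmf f 0 \<and> pmf f 0 < 1 \<and> (\<forall>j. pmf f j = pmf f 0 * (1 - pmf f 0) ^ j)}
      \<in> sets pmf_borel" by measurable
  then show ?thesis by (simp add: geometric_pmf_set_def)
qed

lemma geometric_law_imp: "geometric_law f \<Longrightarrow> f \<in> geometric_pmf_set"
  using geometric_law_pmf unfolding geometric_pmf_set_def mem_Collect_eq by blast

lemma geometric_gen_fun:
  assumes "f \<in> geometric_pmf_set"
  shows "offspring_mean f > 0"
    and "0 \<le> s \<Longrightarrow> s \<le> 1 \<Longrightarrow> gen_fun f s = 1 / (1 + offspring_mean f * (1 - s))"
proof -
  define q p where "q = pmf f 0" and "p = 1 - q"
  have "0 < q" "q < 1" and f: "\<And>j. pmf f j = q * p ^ j"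
    using assms unfolding geometric_pmf_set_def mem_Collect_eq q_def p_def by blast+
  then have pq: "0 < q" "q < 1" "0 < p" "p < 1" by (simp_all add: p_def)
  have "(\<lambda>j. q * (p ^ j * real j)) sums (q * (p / (1 - p)\<^sup>2))"
    using pq by (intro sums_mult geometric_sums_times_n) auto
  then have "(\<lambda>j. real j * pmf f j) sums (p / q)"
    using pq by (simp add: f mult_ac p_def power2_eq_square)
  then have m: "offspring_mean f = p / q"
    by (simp add: offspring_mean_def sums_iff)
  then show "offspring_mean f > 0" using pq by simp
  assume s: "0 \<le> s" "s \<le> 1"
  have ps: "p * s < 1"
  proof -
    have "p * s \<le> p * 1" using s pq by (intro mult_left_mono) auto
    then show ?thesis using pq by linarith
  qed
  have "(\<lambda>j. q * (p * s) ^ j) sums (q * (1 / (1 - p * s)))"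
    using ps s pq by (intro sums_mult geometric_sums) simp
  then have "gen_fun f s = q / (1 - p * s)"
    by (simp add: gen_fun_def f power_mult_distrib mult_ac sums_iff)
  moreover have "q * (1 + p / q * (1 - s)) = 1 - p * s"
    using pq by (simp add: field_simps p_def)
  ultimately show "gen_fun f s = 1 / (1 + offspring_mean f * (1 - s))"
    using pq nonzero_divide_mult_cancel_left[of q "1 + p / q * (1 - s)"] unfolding m by simp
qed

section \<open>Genealogy\<close>

lemma clan_empty: "i > n \<Longrightarrow> clan x i n = {}"
  by (induction n) auto

lemma pop_Suc_eq: "pop x (Suc m) = Suc (pop_before x (Suc m))"
  by (simp add: pop_before_def)

lemma children_disjoint:
  assumes "l \<in> children x n j" "l \<in> children x n k"
  shows "j = k"
proof -
  have "\<not> j < k" if "l \<in> children x n j" "l \<in> children x n k" for j k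
  proof
    assume "j < k"
    then have "(\<Sum>i\<le>j. x n i) \<le> (\<Sum>i<k. x n i)" by (intro sum_mono2) auto
    with that show False by (auto simp: children_def)
  qed
  with assms show ?thesis by (meson linorder_neqE_nat)
qed

lemma children_subset: "k < p \<Longrightarrow> children x n k \<subseteq> {..<(\<Sum>j<p. x n j)}"
proof -
  assume "k < p"
  then have "(\<Sum>j\<le>k. x n j) \<le> (\<Sum>j<p. x n j)" by (intro sum_mono2) auto
  then show ?thesis by (auto simp: children_def)
qed

lemma clan_subset: "clan x i n \<subseteq> {..<pop x n}"
proof (induction n)
  case (Suc n)
  then have "(\<Union>k\<in>clan x i n. children x (Suc n) k) \<subseteq> {..<(\<Sum>j<pop x n. x (Suc n) j)}"
    using children_subset by (intro UN_least) blast
  then show ?case by (auto simp: less_Suc_eq)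
qed auto

lemma prod_children:
  fixes g :: "nat \<Rightarrow> 'b :: comm_monoid_mult"
  shows "(\<Prod>l<(\<Sum>k<p. x n k). g l) = (\<Prod>k<p. \<Prod>l\<in>children x n k. g l)"
proof (induction p)
  case (Suc p)
  have "{..<(\<Sum>k<Suc p. x n k)} = {..<(\<Sum>k<p. x n k)} \<union> children x n p"
    by (auto simp: children_def lessThan_Suc_atMost[symmetric])
  moreover have "{..<(\<Sum>k<p. x n k)} \<inter> children x n p = {}" by (auto simp: children_def)
  ultimately show ?case
    using Suc by (simp add: prod.union_disjoint children_def)
qed simp

lemma card_children: "card (children x n k) = x n k"
  by (simp add: children_def lessThan_Suc_atMost[symmetric])

lemma mem_clan_Suc_iff:
  assumes "k < pop x m" "l \<in> children x (Suc m) k"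
  shows "l \<in> clan x i (Suc m) \<longleftrightarrow> k \<in> clan x i m"
proof (cases "i = Suc m")
  case True
  then show ?thesis
    using children_subset[OF assms(1), of x "Suc m"] assms(2) by (auto simp: clan_empty)
next
  case False
  then show ?thesis
  proof -
    have "l \<in> clan x i (Suc m) \<longleftrightarrow> (\<exists>j\<in>clan x i m. l \<in> children x (Suc m) j)"
      using False by simp
    also have "\<dots> \<longleftrightarrow> k \<in> clan x i m"
      using assms(2) children_disjoint[OF _ assms(2)] by blast
    finally show ?thesis .
  qed
qed

lemma prod_pop_before:
  fixes s t :: "'b :: comm_monoid_mult"
  shows "(\<Prod>l<pop_before x (Suc m). if l \<in> clan x i (Suc m) then t else s)
     = (\<Prod>k<pop x m. (if k \<in> clan x i m then t else s) ^ x (Suc m) k)"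
proof -
  have "(\<Prod>l<pop_before x (Suc m). if l \<in> clan x i (Suc m) then t else s)
      = (\<Prod>k<pop x m. \<Prod>l\<in>children x (Suc m) k. if l \<in> clan x i (Suc m) then t else s)"
    unfolding pop_before_def by (simp only: prod_children diff_Suc_1)
  also have "\<dots> = (\<Prod>k<pop x m. \<Prod>l\<in>children x (Suc m) k. if k \<in> clan x i m then t else s)"
    by (intro prod.cong refl) (simp add: mem_clan_Suc_iff del: clan.simps)
  finally show ?thesis by (simp add: card_children)
qed

lemma immigrant_mem_clan_iff: "pop_before x (Suc m) \<in> clan x i (Suc m) \<longleftrightarrow> i = Suc m"
proof (cases "i = Suc m")
  case False
  have "(\<Union>k\<in>clan x i m. children x (Suc m) k) \<subseteq> {..<pop_before x (Suc m)}"
    unfolding pop_before_def diff_Suc_1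
    using clan_subset[of x i m] by (intro UN_least children_subset) auto
  with False show ?thesis by auto
qed (simp add: pop_before_def)

lemma prod_pop_Suc:
  fixes s t :: "'b :: comm_monoid_mult"
  shows "(\<Prod>l<pop x (Suc m). if l \<in> clan x i (Suc m) then t else s)
     = (if i = Suc m then t else s) * (\<Prod>k<pop x m. (if k \<in> clan x i m then t else s) ^ x (Suc m) k)"
  unfolding pop_Suc_eq by (simp add: immigrant_mem_clan_iff prod_pop_before mult.commute del: clan.simps)

section \<open>Conditioning on the environment and the past\<close>

lemma borel_measurable_indicator_count_space:
  "N \<in> M \<rightarrow>\<^sub>M count_space UNIV \<Longrightarrow> (\<lambda>\<omega>. indicator A (N \<omega>) :: ennreal) \<in> borel_measurable M"
  by (erule measurable_compose) simp

lemma nn_integral_partition_nat: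
  assumes [measurable]: "f \<in> borel_measurable M" "N \<in> M \<rightarrow>\<^sub>M count_space (UNIV :: nat set)"
  shows "(\<integral>\<^sup>+\<omega>. f \<omega> \<partial>M) = (\<Sum>p. \<integral>\<^sup>+\<omega>. f \<omega> * indicator {p} (N \<omega>) \<partial>M)"
proof -
  have "(\<Sum>p. f \<omega> * indicator {p} (N \<omega>)) = f \<omega>" for \<omega>
    by (subst suminf_finite[of "{N \<omega>}"]) (auto simp: indicator_def)
  moreover have "(\<lambda>\<omega>. f \<omega> * indicator {p} (N \<omega>)) \<in> borel_measurable M" for p
    using borel_measurable_indicator_count_space[OF assms(2), of "{p}"] by measurable
  ultimately show ?thesis
    by (subst nn_integral_suminf[symmetric]) (simp_all only:)
qed

context bpire
begin

abbreviation env :: "'a measure" where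
  "env \<equiv> env_algebra M Fs"

abbreviation offspring :: "'a \<Rightarrow> nat \<Rightarrow> nat \<Rightarrow> nat" where
  "offspring \<omega> \<equiv> \<lambda>n k. \<xi> n k \<omega>"

definition cylinder :: "(nat \<times> nat) set \<Rightarrow> (nat \<Rightarrow> nat \<Rightarrow> nat) \<Rightarrow> 'a set" where
  "cylinder J x = {\<omega>\<in>space M. \<forall>(n, k)\<in>J. \<xi> n k \<omega> = x n k}"

definition history :: "(nat \<times> nat) set \<Rightarrow> 'a measure" where
  "history I = sigma (space M) {C \<inter> cylinder J x | C J x. C \<in> sets env \<and> finite J \<and> J \<subseteq> I}"

lemma Fs_measurable_M: "n \<ge> 1 \<Longrightarrow> Fs n \<in> M \<rightarrow>\<^sub>M pmf_borel"
  using env_indep by (auto simp: indep_vars_def)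

lemma env_map_measurable: "(\<lambda>\<omega>. \<lambda>n\<in>{1..}. Fs n \<omega>) \<in> M \<rightarrow>\<^sub>M PiM {1..} (\<lambda>_. pmf_borel)"
  by (intro measurable_restrict Fs_measurable_M) simp

lemma subalgebra_env: "subalgebra M env"
proof -
  have "sets env \<subseteq> sets M"
    unfolding env_algebra_def using measurable_sets[OF env_map_measurable]
    by (auto simp: sets_vimage_algebra2 space_PiM PiE_iff)
  then show ?thesis by (simp add: subalgebra_def env_algebra_def)
qed

lemma Fs_measurable_env [measurable]:
  assumes "n \<ge> 1"
  shows "Fs n \<in> env \<rightarrow>\<^sub>M pmf_borel"
proof -
  have "(\<lambda>\<omega>. \<lambda>n\<in>{1..}. Fs n \<omega>) \<in> env \<rightarrow>\<^sub>M PiM {1..} (\<lambda>_. pmf_borel)"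
    unfolding env_algebra_def by (intro measurable_vimage_algebra1) (auto simp: space_PiM)
  from measurable_compose[OF this measurable_component_singleton[of n]] assms
  show ?thesis by simp
qed

lemma space_env: "space env = space M"
  using subalgebra_env by (simp add: subalgebra_def)

lemma sets_cylinder:
  assumes "finite J" "J \<subseteq> {1..} \<times> UNIV"
  shows "cylinder J x \<in> sets M"
proof -
  have "{\<omega>\<in>space M. \<forall>j\<in>J. \<xi> (fst j) (snd j) \<omega> = x (fst j) (snd j)} \<in> sets M"
    using assms
  proof (intro sets.sets_Collect_finite_All)
    fix j assume "j \<in> J"
    then have [measurable]: "\<xi> (fst j) (snd j) \<in> M \<rightarrow>\<^sub>M count_space UNIV"
      using assms by (intro offspring_measurable) auto
    show "{\<omega> \<in> space M. \<xi> (fst j) (snd j) \<omega> = x (fst j) (snd j)} \<in> sets M"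
      by measurable
  qed
  then show ?thesis by (simp add: cylinder_def case_prod_beta)
qed

lemma space_history [simp]: "space (history I) = space M"
  by (simp add: history_def space_measure_of_conv)

lemma history_generator_closed:
  "{C \<inter> cylinder J x | C J x. C \<in> sets env \<and> finite J \<and> J \<subseteq> I} \<subseteq> Pow (space M)"
  by (auto simp: cylinder_def)

lemma sets_history:
  "sets (history I) = sigma_sets (space M) {C \<inter> cylinder J x | C J x. C \<in> sets env \<and> finite J \<and> J \<subseteq> I}"
  unfolding history_def by (rule sets_measure_of[OF history_generator_closed])

lemma subalgebra_history:
  assumes "I \<subseteq> {1..} \<times> UNIV"
  shows "subalgebra M (history I)"
proof -
  have "{C \<inter> cylinder J x | C J x. C \<in> sets env \<and> finite J \<and> J \<subseteq> I} \<subseteq> sets M"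
  proof safe
    fix C J x assume "C \<in> sets env" "finite J" "J \<subseteq> I"
    then show "C \<inter> cylinder J x \<in> sets M"
      using subalgebra_env assms by (intro sets.Int sets_cylinder) (auto simp: subalgebra_def)
  qed
  then show ?thesis
    unfolding subalgebra_def sets_history by (simp add: sets.sigma_sets_subset)
qed

lemma history_mono: "I \<subseteq> I' \<Longrightarrow> subalgebra (history I') (history I)"
  unfolding subalgebra_def sets_history space_history
  by (intro conjI refl sigma_sets_mono' Collect_mono ex_mono impI) (simp, meson subset_trans)

lemma subalgebra_history_env: "subalgebra (history I) env"
  unfolding subalgebra_def
proof
  show "sets env \<subseteq> sets (history I)"
  proof
    fix C assume C: "C \<in> sets env"
    then have "C = C \<inter> cylinder {} (\<lambda>_ _. 0)"
      using sets.sets_into_space[OF C] by (auto simp: cylinder_def space_env)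
    then show "C \<in> sets (history I)"
      unfolding sets_history using C by (intro sigma_sets.Basic) blast
  qed
qed (simp add: space_env)

lemma offspring_measurable_history:
  assumes "(n, k) \<in> I"
  shows "\<xi> n k \<in> history I \<rightarrow>\<^sub>M count_space UNIV"
proof (subst measurable_count_space_eq2_countable, intro conjI ballI)
  fix j :: nat
  have "\<xi> n k -` {j} \<inter> space (history I) = space env \<inter> cylinder {(n, k)} (\<lambda>_ _. j)"
    by (auto simp: cylinder_def space_env)
  also have "\<dots> \<in> sets (history I)"
    unfolding sets_history using assms by (intro sigma_sets.Basic) blast
  finally show "\<xi> n k -` {j} \<inter> space (history I) \<in> sets (history I)" .
qed auto

lemma integral_cylinder:
  assumes h [measurable]: "h \<in> borel_measurable env" and "\<And>\<omega>. \<bar>h \<omega>\<bar> \<le> 1"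
    and J: "finite J" "J \<subseteq> {1..} \<times> UNIV"
  shows "(\<integral>\<omega>. h \<omega> * indicator (cylinder J x) \<omega> \<partial>M)
    = (\<integral>\<omega>. h \<omega> * (\<Prod>(n, k)\<in>J. pmf (Fs n \<omega>) (x n k)) \<partial>M)"
proof -
  interpret finite_measure_subalgebra M env
    using subalgebra_env by unfold_locales
  have [measurable]: "h \<in> borel_measurable M"
    using measurable_from_subalg[OF subalgebra_env h] .
  have [measurable]: "cylinder J x \<in> sets M" using sets_cylinder[OF J] .
  have "integrable M (\<lambda>\<omega>. h \<omega> * indicator (cylinder J x) \<omega>)"
    using assms(2) by (intro integrable_const_bound[where B = 1]) (auto simp: indicator_def)
  then have "(\<integral>\<omega>. h \<omega> * real_cond_exp M env (indicator (cylinder J x)) \<omega> \<partial>M)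
      = (\<integral>\<omega>. h \<omega> * indicator (cylinder J x) \<omega> \<partial>M)"
    by (intro real_cond_exp_intg h) auto
  moreover have "(\<integral>\<omega>. h \<omega> * real_cond_exp M env (indicator (cylinder J x)) \<omega> \<partial>M)
      = (\<integral>\<omega>. h \<omega> * (\<Prod>(n, k)\<in>J. pmf (Fs n \<omega>) (x n k)) \<partial>M)"
  proof (rule integral_cong_AE)
    have "Fs (fst j) \<in> M \<rightarrow>\<^sub>M pmf_borel" if "j \<in> J" for j
      using that J by (intro Fs_measurable_M) auto
    then have "(\<lambda>\<omega>. \<Prod>(n, k)\<in>J. pmf (Fs n \<omega>) (x n k)) \<in> borel_measurable M"
      unfolding case_prod_beta
      by (intro borel_measurable_prod) (blast intro: measurable_compose[OF _ borel_measurable_pmf])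
    then show "(\<lambda>\<omega>. h \<omega> * (\<Prod>(n, k)\<in>J. pmf (Fs n \<omega>) (x n k))) \<in> borel_measurable M"
      by measurable
    show "AE \<omega> in M. h \<omega> * real_cond_exp M env (indicator (cylinder J x)) \<omega>
        = h \<omega> * (\<Prod>(n, k)\<in>J. pmf (Fs n \<omega>) (x n k))"
      using offspring_law[OF J, of x] unfolding cylinder_def by eventually_elim simp
  qed measurable
  ultimately show ?thesis by simp
qed

lemma cylinder_cong: "(\<And>n k. (n, k) \<in> J \<Longrightarrow> x n k = z n k) \<Longrightarrow> cylinder J x = cylinder J z"
  by (auto simp: cylinder_def)

lemma Int_stable_history_generator:
  "Int_stable {C \<inter> cylinder J x | C J x. C \<in> sets env \<and> finite J \<and> J \<subseteq> I}"
proof (rule Int_stableI)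
  fix A B
  assume "A \<in> {C \<inter> cylinder J x | C J x. C \<in> sets env \<and> finite J \<and> J \<subseteq> I}"
    and "B \<in> {C \<inter> cylinder J x | C J x. C \<in> sets env \<and> finite J \<and> J \<subseteq> I}"
  then obtain C J x C' J' x' where A: "A = C \<inter> cylinder J x" "C \<in> sets env" "finite J" "J \<subseteq> I"
    and B: "B = C' \<inter> cylinder J' x'" "C' \<in> sets env" "finite J'" "J' \<subseteq> I" by blast
  define z where "z n k = (if (n, k) \<in> J then x n k else x' n k)" for n k
  have "\<exists>D\<in>sets env. A \<inter> B = D \<inter> cylinder (J \<union> J') z"
  proof (cases "\<forall>(n, k)\<in>J \<inter> J'. x n k = x' n k")
    case True
    then have T: "x n k = x' n k" if "(n, k) \<in> J" "(n, k) \<in> J'" for n k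
      using that by blast
    have "cylinder (J \<union> J') z = cylinder J z \<inter> cylinder J' z"
      by (auto simp: cylinder_def)
    moreover have "cylinder J x = cylinder J z" "cylinder J' x' = cylinder J' z"
      by (rule cylinder_cong; simp add: z_def T)+
    ultimately have "cylinder J x \<inter> cylinder J' x' = cylinder (J \<union> J') z" by simp
    then have "A \<inter> B = (C \<inter> C') \<inter> cylinder (J \<union> J') z" using A(1) B(1) by blast
    then show ?thesis using A(2) B(2) by blast
  next
    case False
    then obtain n k where "(n, k) \<in> J" "(n, k) \<in> J'" "x n k \<noteq> x' n k" by blast
    moreover have "\<xi> n k \<omega> = y n k" if "\<omega> \<in> cylinder L y" "(n, k) \<in> L" for \<omega> L y
      using that unfolding cylinder_def by blast
    ultimately have "cylinder J x \<inter> cylinder J' x' = {}"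
      by (metis disjoint_iff)
    then have "A \<inter> B = {} \<inter> cylinder (J \<union> J') z" using A(1) B(1) by blast
    then show ?thesis by blast
  qed
  then show "A \<inter> B \<in> {C \<inter> cylinder J x | C J x. C \<in> sets env \<and> finite J \<and> J \<subseteq> I}"
    using A B by blast
qed

lemma emeasure_offspring:
  assumes I: "I \<subseteq> {1..} \<times> UNIV" and nk: "n \<ge> 1" "(n, k) \<notin> I" and A: "A \<in> sets (history I)"
  shows "emeasure (density M (\<lambda>\<omega>. indicator {j} (\<xi> n k \<omega>))) A
    = emeasure (density M (\<lambda>\<omega>. ennreal (pmf (Fs n \<omega>) j))) A"
    (is "emeasure ?U A = emeasure ?V A")
proof -
  note U = offspring_measurable[OF nk(1), of k]
  note [measurable] = U borel_measurable_indicator_count_space[OF U] Fs_measurable_M[OF nk(1)]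
  note sub = subalgebra_history[OF I, unfolded subalgebra_def, THEN conjunct2, THEN subsetD, unfolded sets_history]
  have basic: "emeasure ?U A = emeasure ?V A"
    if C: "C \<in> sets env" and J: "finite J" "J \<subseteq> I" and A: "A = C \<inter> cylinder J x" for C J x A
  proof -
    define x' where "x' = x(n := (x n)(k := j))"
    have nkJ: "(n, k) \<notin> J" using J nk by blast
    have J1: "J \<subseteq> {1..} \<times> UNIV" "insert (n, k) J \<subseteq> {1..} \<times> UNIV" "finite (insert (n, k) J)"
      using J I nk by auto
    have [measurable]: "C \<in> sets M" using C subalgebra_env by (auto simp: subalgebra_def)
    have [measurable]: "cylinder J x \<in> sets M" by (intro sets_cylinder J J1)
    have x': "x' m l = x m l" if "(m, l) \<in> J" for m l using that nkJ by (auto simp: x'_def)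
    have cyl: "cylinder (insert (n, k) J) x' = cylinder J x \<inter> {\<omega>\<in>space M. \<xi> n k \<omega> = j}"
      using x' unfolding cylinder_def by (auto simp: x'_def)
    have prd: "(\<Prod>(m, l)\<in>insert (n, k) J. pmf (Fs m \<omega>) (x' m l))
        = pmf (Fs n \<omega>) j * (\<Prod>(m, l)\<in>J. pmf (Fs m \<omega>) (x m l))" for \<omega>
    proof -
      have "(\<Prod>(m, l)\<in>J. pmf (Fs m \<omega>) (x' m l)) = (\<Prod>(m, l)\<in>J. pmf (Fs m \<omega>) (x m l))"
        by (intro prod.cong refl) (auto simp: x')
      then show ?thesis using J nkJ by (simp add: x'_def)
    qed
    have A': "A \<in> sets M" unfolding A by measurable
    have "emeasure ?U A = (\<integral>\<^sup>+\<omega>. ennreal (indicator C \<omega> * indicator (cylinder (insert (n, k) J) x') \<omega>) \<partial>M)"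
      using A' unfolding cyl
      by (subst emeasure_density) (auto simp: A indicator_def intro!: nn_integral_cong)
    also have "\<dots> = ennreal (\<integral>\<omega>. indicator C \<omega> * indicator (cylinder (insert (n, k) J) x') \<omega> \<partial>M)"
      using sets_cylinder[OF J1(3,2), of x']
      by (intro nn_integral_eq_integral integrable_const_bound[where B = 1])
         (auto simp: indicator_def)
    also have "(\<integral>\<omega>. indicator C \<omega> * indicator (cylinder (insert (n, k) J) x') \<omega> \<partial>M)
        = (\<integral>\<omega>. indicator C \<omega> * (\<Prod>(m, l)\<in>insert (n, k) J. pmf (Fs m \<omega>) (x' m l)) \<partial>M)"
      using C J1 by (intro integral_cylinder) (auto simp: indicator_def)
    also have "\<dots> = (\<integral>\<omega>. (indicator C \<omega> * pmf (Fs n \<omega>) j) * (\<Prod>(m, l)\<in>J. pmf (Fs m \<omega>) (x m l)) \<partial>M)"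
      unfolding prd by (simp only: mult.assoc)
    also have "\<dots> = (\<integral>\<omega>. (indicator C \<omega> * pmf (Fs n \<omega>) j) * indicator (cylinder J x) \<omega> \<partial>M)"
    proof (rule integral_cylinder[symmetric])
      have [measurable]: "Fs n \<in> env \<rightarrow>\<^sub>M pmf_borel" using nk(1) by (rule Fs_measurable_env)
      show "(\<lambda>\<omega>. indicator C \<omega> * pmf (Fs n \<omega>) j) \<in> borel_measurable env"
        using C by measurable
    qed (use J J1 in \<open>auto simp: indicator_def pmf_le_1\<close>)
    also have "ennreal \<dots> = (\<integral>\<^sup>+\<omega>. ennreal ((indicator C \<omega> * pmf (Fs n \<omega>) j) * indicator (cylinder J x) \<omega>) \<partial>M)"
      by (intro nn_integral_eq_integral[symmetric] integrable_const_bound[where B = 1])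
         (auto simp: indicator_def pmf_le_1)
    also have "\<dots> = emeasure ?V A"
      using A' by (subst emeasure_density) (auto simp: A indicator_def intro!: nn_integral_cong)
    finally show ?thesis .
  qed
  have fin: "finite_measure ?U" "finite_measure ?V"
  proof -
    have *: "emeasure (density M g) (space M) \<le> 1"
      if [measurable]: "g \<in> borel_measurable M" and "\<And>\<omega>. g \<omega> \<le> 1" for g :: "'a \<Rightarrow> ennreal"
    proof -
      have "emeasure (density M g) (space M) = (\<integral>\<^sup>+\<omega>. g \<omega> * indicator (space M) \<omega> \<partial>M)"
        by (rule emeasure_density) measurable
      also have "\<dots> \<le> (\<integral>\<^sup>+\<omega>. 1 \<partial>M)"
        using that(2) by (intro nn_integral_mono) (auto simp: indicator_def)
      finally show ?thesis by (simp add: emeasure_space_1)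
    qed
    have "emeasure ?U (space M) \<le> 1" "emeasure ?V (space M) \<le> 1"
      by (rule *; simp add: indicator_def pmf_le_1 borel_measurable_indicator_count_space[OF U])+
    then show "finite_measure ?U" "finite_measure ?V"
      by (auto intro!: finite_measureI simp: top_unique)
  qed
  have total: "emeasure ?U (space M) = emeasure ?V (space M)"
    using sets.top[of env] by (intro basic[of "space env" "{}" _ "\<lambda>_ _. 0"]) (auto simp: cylinder_def space_env)
  from Int_stable_history_generator history_generator_closed A[unfolded sets_history] show ?thesis
  proof (induction rule: sigma_sets_induct_disjoint)
    case (basic A)
    then show ?case using \<open>\<And>C J x A. C \<in> sets env \<Longrightarrow> finite J \<Longrightarrow> J \<subseteq> I \<Longrightarrow> A = C \<inter> cylinder J x \<Longrightarrow> emeasure ?U A = emeasure ?V A\<close>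
      by blast
  next
    case empty
    then show ?case by simp
  next
    case (compl A)
    then have "A \<in> sets M" using sub by blast
    then show ?case
      using compl total finite_measure.emeasure_finite[OF fin(1)] finite_measure.emeasure_finite[OF fin(2)]
        emeasure_compl[of A ?U] emeasure_compl[of A ?V] by simp
  next
    case (union A)
    then have "range A \<subseteq> sets M" using sub by blast
    then show ?case
      using union suminf_emeasure[of A ?U] suminf_emeasure[of A ?V] by simp
  qed
qed

lemma nn_integral_offspring:
  assumes I: "I \<subseteq> {1..} \<times> UNIV" and nk: "n \<ge> 1" "(n, k) \<notin> I" and H: "H \<in> borel_measurable (history I)"
  shows "(\<integral>\<^sup>+\<omega>. H \<omega> * indicator {j} (\<xi> n k \<omega>) \<partial>M) = (\<integral>\<^sup>+\<omega>. H \<omega> * ennreal (pmf (Fs n \<omega>) j) \<partial>M)"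
proof -
  note [measurable] = offspring_measurable[OF nk(1), of k] Fs_measurable_M[OF nk(1)]
  note sub = subalgebra_history[OF I]
  have [measurable]: "H \<in> borel_measurable M" using measurable_from_subalg[OF sub H] .
  let ?U = "density M (\<lambda>\<omega>. indicator {j} (\<xi> n k \<omega>))" and ?V = "density M (\<lambda>\<omega>. ennreal (pmf (Fs n \<omega>) j))"
  have subU: "subalgebra ?U (history I)" "subalgebra ?V (history I)"
    using sub by (simp_all add: subalgebra_def)
  have "restr_to_subalg ?U (history I) = restr_to_subalg ?V (history I)"
    by (rule measure_eqI)
       (auto simp: sets_restr_to_subalg[OF subU(1)] sets_restr_to_subalg[OF subU(2)]
         emeasure_restr_to_subalg[OF subU(1)] emeasure_restr_to_subalg[OF subU(2)] emeasure_offspring[OF I nk])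
  then have "(\<integral>\<^sup>+\<omega>. H \<omega> \<partial>?U) = (\<integral>\<^sup>+\<omega>. H \<omega> \<partial>?V)"
    using nn_integral_subalgebra2[OF subU(1) H] nn_integral_subalgebra2[OF subU(2) H] by simp
  moreover have "(\<integral>\<^sup>+\<omega>. H \<omega> \<partial>?U) = (\<integral>\<^sup>+\<omega>. indicator {j} (\<xi> n k \<omega>) * H \<omega> \<partial>M)"
    by (intro nn_integral_density borel_measurable_indicator_count_space offspring_measurable nk) measurable
  moreover have "(\<integral>\<^sup>+\<omega>. H \<omega> \<partial>?V) = (\<integral>\<^sup>+\<omega>. ennreal (pmf (Fs n \<omega>) j) * H \<omega> \<partial>M)"
    by (rule nn_integral_density) measurable
  ultimately show ?thesis by (simp only: mult.commute)
qed

lemma nn_integral_power_offspring: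
  fixes w :: "'a \<Rightarrow> real"
  assumes I: "I \<subseteq> {1..} \<times> UNIV" and nk: "n \<ge> 1" "(n, k) \<notin> I"
    and H: "H \<in> borel_measurable (history I)" and w: "w \<in> borel_measurable (history I)"
    and w01: "\<And>\<omega>. 0 \<le> w \<omega>" "\<And>\<omega>. w \<omega> \<le> 1"
  shows "(\<integral>\<^sup>+\<omega>. H \<omega> * ennreal (w \<omega> ^ \<xi> n k \<omega>) \<partial>M) = (\<integral>\<^sup>+\<omega>. H \<omega> * ennreal (gen_fun (Fs n \<omega>) (w \<omega>)) \<partial>M)"
proof -
  note [measurable] = offspring_measurable[OF nk(1), of k] Fs_measurable_M[OF nk(1)] H w
  note sub = subalgebra_history[OF I]
  have [measurable]: "H \<in> borel_measurable M" "w \<in> borel_measurable M"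
    using measurable_from_subalg[OF sub H] measurable_from_subalg[OF sub w] .
  have "(\<integral>\<^sup>+\<omega>. H \<omega> * ennreal (w \<omega> ^ \<xi> n k \<omega>) \<partial>M)
      = (\<Sum>j. \<integral>\<^sup>+\<omega>. (H \<omega> * ennreal (w \<omega> ^ \<xi> n k \<omega>)) * indicator {j} (\<xi> n k \<omega>) \<partial>M)"
    by (rule nn_integral_partition_nat) measurable
  also have "\<dots> = (\<Sum>j. \<integral>\<^sup>+\<omega>. (H \<omega> * ennreal (w \<omega> ^ j)) * indicator {j} (\<xi> n k \<omega>) \<partial>M)"
    by (intro suminf_cong nn_integral_cong) (auto simp: indicator_def)
  also have "\<dots> = (\<Sum>j. \<integral>\<^sup>+\<omega>. (H \<omega> * ennreal (w \<omega> ^ j)) * ennreal (pmf (Fs n \<omega>) j) \<partial>M)"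
    by (intro suminf_cong nn_integral_offspring[OF I nk]) measurable
  also have "\<dots> = (\<integral>\<^sup>+\<omega>. (\<Sum>j. (H \<omega> * ennreal (w \<omega> ^ j)) * ennreal (pmf (Fs n \<omega>) j)) \<partial>M)"
    by (rule nn_integral_suminf[symmetric]) measurable
  also have "\<dots> = (\<integral>\<^sup>+\<omega>. H \<omega> * ennreal (gen_fun (Fs n \<omega>) (w \<omega>)) \<partial>M)"
  proof (rule nn_integral_cong)
    fix \<omega>
    have "(\<Sum>j. (H \<omega> * ennreal (w \<omega> ^ j)) * ennreal (pmf (Fs n \<omega>) j))
        = (\<Sum>j. H \<omega> * ennreal (pmf (Fs n \<omega>) j * w \<omega> ^ j))"
      using w01 by (intro suminf_cong) (simp add: ennreal_mult' mult_ac)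
    also have "\<dots> = H \<omega> * (\<Sum>j. ennreal (pmf (Fs n \<omega>) j * w \<omega> ^ j))"
      by simp
    also have "(\<Sum>j. ennreal (pmf (Fs n \<omega>) j * w \<omega> ^ j)) = ennreal (gen_fun (Fs n \<omega>) (w \<omega>))"
      using gen_fun_sums[OF w01, of "Fs n \<omega>" \<omega>] w01
      by (intro suminf_ennreal_eq) auto
    finally show "(\<Sum>j. (H \<omega> * ennreal (w \<omega> ^ j)) * ennreal (pmf (Fs n \<omega>) j))
        = H \<omega> * ennreal (gen_fun (Fs n \<omega>) (w \<omega>))" .
  qed
  finally show ?thesis .
qed

end

text \<open>\<open>pgf_comp f n N s = f (n - N + 1) (\<dots> (f n s))\<close>\<close>
primrec pgf_comp :: "(nat \<Rightarrow> nat pmf) \<Rightarrow> nat \<Rightarrow> nat \<Rightarrow> real \<Rightarrow> real" where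
  "pgf_comp f n 0 s = s"
| "pgf_comp f n (Suc N) s = gen_fun (f (n - N)) (pgf_comp f n N s)"

lemma pgf_comp_bounds:
  assumes "0 \<le> s" "s \<le> 1"
  shows "0 \<le> pgf_comp f n N s \<and> pgf_comp f n N s \<le> 1"
  using assms by (induction N) (auto simp: gen_fun_bounds)

lemma pgf_comp_1 [simp]: "pgf_comp f n N 1 = 1"
  by (induction N) auto

context bpire
begin

lemma nn_integral_prod_offspring:
  fixes w :: "nat \<Rightarrow> 'a \<Rightarrow> real"
  assumes n: "n \<ge> 1" and I: "I \<subseteq> {1..} \<times> UNIV" "\<And>k. (n, k) \<notin> I"
    and w: "\<And>k. w k \<in> borel_measurable (history I)"
    and w01: "\<And>k \<omega>. 0 \<le> w k \<omega>" "\<And>k \<omega>. w k \<omega> \<le> 1"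
    and H: "H \<in> borel_measurable (history I)"
  shows "(\<integral>\<^sup>+\<omega>. H \<omega> * (\<Prod>k<p. ennreal (w k \<omega> ^ \<xi> n k \<omega>)) \<partial>M)
    = (\<integral>\<^sup>+\<omega>. H \<omega> * (\<Prod>k<p. ennreal (gen_fun (Fs n \<omega>) (w k \<omega>))) \<partial>M)"
  using H
proof (induction p arbitrary: H)
  case (Suc p)
  let ?I = "I \<union> {n} \<times> {..<p}"
  have I': "?I \<subseteq> {1..} \<times> UNIV" "(n, p) \<notin> ?I" using I n by auto
  have sub: "f \<in> borel_measurable (history ?I)" if "f \<in> borel_measurable (history I)" for f :: "'a \<Rightarrow> 'c :: topological_space"
    by (rule measurable_from_subalg[OF history_mono that]) simp
  have [measurable]: "\<xi> n k \<in> history ?I \<rightarrow>\<^sub>M count_space UNIV" if "k < p" for k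
    using that by (intro offspring_measurable_history) simp
  note [measurable] = sub[OF w] sub[OF Suc.prems]
  have "(\<integral>\<^sup>+\<omega>. H \<omega> * (\<Prod>k<Suc p. ennreal (w k \<omega> ^ \<xi> n k \<omega>)) \<partial>M)
      = (\<integral>\<^sup>+\<omega>. (H \<omega> * (\<Prod>k<p. ennreal (w k \<omega> ^ \<xi> n k \<omega>))) * ennreal (w p \<omega> ^ \<xi> n p \<omega>) \<partial>M)"
    by (simp add: mult.assoc)
  also have "\<dots> = (\<integral>\<^sup>+\<omega>. (H \<omega> * (\<Prod>k<p. ennreal (w k \<omega> ^ \<xi> n k \<omega>))) * ennreal (gen_fun (Fs n \<omega>) (w p \<omega>)) \<partial>M)"
  proof (rule nn_integral_power_offspring[OF I'(1) n I'(2)])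
    have "(\<lambda>\<omega>. \<Prod>k<p. ennreal (w k \<omega> ^ \<xi> n k \<omega>)) \<in> borel_measurable (history ?I)"
      by (intro borel_measurable_prod_ennreal) (simp, measurable)
    then show "(\<lambda>\<omega>. H \<omega> * (\<Prod>k<p. ennreal (w k \<omega> ^ \<xi> n k \<omega>))) \<in> borel_measurable (history ?I)"
      by measurable
  qed (use sub[OF w] w01 in auto)
  also have "\<dots> = (\<integral>\<^sup>+\<omega>. (H \<omega> * ennreal (gen_fun (Fs n \<omega>) (w p \<omega>))) * (\<Prod>k<p. ennreal (w k \<omega> ^ \<xi> n k \<omega>)) \<partial>M)"
    by (simp only: mult_ac)
  also have "\<dots> = (\<integral>\<^sup>+\<omega>. (H \<omega> * ennreal (gen_fun (Fs n \<omega>) (w p \<omega>))) * (\<Prod>k<p. ennreal (gen_fun (Fs n \<omega>) (w k \<omega>))) \<partial>M)"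
  proof (rule Suc.IH)
    have [measurable]: "Fs n \<in> history I \<rightarrow>\<^sub>M pmf_borel"
      by (rule measurable_from_subalg[OF subalgebra_history_env Fs_measurable_env[OF n]])
    note [measurable] = w Suc.prems
    show "(\<lambda>\<omega>. H \<omega> * ennreal (gen_fun (Fs n \<omega>) (w p \<omega>))) \<in> borel_measurable (history I)"
      by measurable
  qed
  finally show ?case by (simp add: mult_ac)
qed simp

abbreviation past :: "nat \<Rightarrow> 'a measure" where
  "past m \<equiv> history ({1..m} \<times> UNIV)"

lemma subalgebra_past: "subalgebra M (past m)"
  by (rule subalgebra_history) auto

lemma past_Suc: "subalgebra (past (Suc m)) (past m)"
  by (rule history_mono) auto

lemma offspring_measurable_past: "\<xi> (Suc m) k \<in> past (Suc m) \<rightarrow>\<^sub>M count_space UNIV"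
  by (rule offspring_measurable_history) simp

lemma sum_offspring_measurable_past:
  "(\<lambda>\<omega>. \<Sum>k<p. \<xi> (Suc m) k \<omega>) \<in> past (Suc m) \<rightarrow>\<^sub>M count_space UNIV"
proof (induction p)
  case (Suc p)
  note [measurable] = Suc offspring_measurable_past
  show ?case unfolding sum.lessThan_Suc by measurable
qed simp

lemma pop_measurable_past: "(\<lambda>\<omega>. pop (offspring \<omega>) m) \<in> past m \<rightarrow>\<^sub>M count_space UNIV"
proof (induction m)
  case (Suc m)
  have pm [measurable]: "(\<lambda>\<omega>. pop (offspring \<omega>) m) \<in> past (Suc m) \<rightarrow>\<^sub>M count_space UNIV"
    by (rule measurable_from_subalg[OF past_Suc Suc])
  have "(\<lambda>\<omega>. \<Sum>k<pop (offspring \<omega>) m. \<xi> (Suc m) k \<omega>) \<in> past (Suc m) \<rightarrow>\<^sub>M count_space UNIV"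
    by (rule measurable_compose_countable'[OF sum_offspring_measurable_past pm]) simp
  from measurable_compose[OF this, of "\<lambda>a. a + 1"] show ?case by simp
qed simp

lemma clan_measurable_past: "(\<lambda>\<omega>. l \<in> clan (offspring \<omega>) i m) \<in> past m \<rightarrow>\<^sub>M count_space UNIV"
proof (induction m arbitrary: l)
  case (Suc m)
  have [measurable]: "(\<lambda>\<omega>. k \<in> clan (offspring \<omega>) i m) \<in> past (Suc m) \<rightarrow>\<^sub>M count_space UNIV" for k
    by (rule measurable_from_subalg[OF past_Suc Suc])
  note [measurable] = pop_measurable_past[of "Suc m"]
  have [measurable]: "(\<lambda>\<omega>. (\<Sum>j<k. \<xi> (Suc m) j \<omega>) \<le> l) \<in> past (Suc m) \<rightarrow>\<^sub>M count_space UNIV"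
    "(\<lambda>\<omega>. l < (\<Sum>j<k. \<xi> (Suc m) j \<omega>)) \<in> past (Suc m) \<rightarrow>\<^sub>M count_space UNIV" for k
    by (rule measurable_compose[OF sum_offspring_measurable_past]; simp)+
  show ?case
  proof (cases "i = Suc m")
    case True
    have "(\<lambda>\<omega>. l = pop (offspring \<omega>) (Suc m) - 1) \<in> past (Suc m) \<rightarrow>\<^sub>M count_space UNIV"
      by measurable
    then show ?thesis using True by simp
  next
    case False
    have "(\<lambda>\<omega>. \<exists>k. k \<in> clan (offspring \<omega>) i m \<and> (\<Sum>j<k. \<xi> (Suc m) j \<omega>) \<le> l \<and> l < (\<Sum>j<Suc k. \<xi> (Suc m) j \<omega>))
        \<in> past (Suc m) \<rightarrow>\<^sub>M count_space UNIV"
      by measurable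
    then show ?thesis using False by (simp add: children_def Bex_def lessThan_Suc_atMost del: sum.lessThan_Suc)
  qed
qed simp

lemma nn_integral_generation:
  fixes s t :: "'a \<Rightarrow> real"
  assumes s: "s \<in> borel_measurable env" "\<And>\<omega>. 0 \<le> s \<omega>" "\<And>\<omega>. s \<omega> \<le> 1"
    and t: "t \<in> borel_measurable env" "\<And>\<omega>. 0 \<le> t \<omega>" "\<And>\<omega>. t \<omega> \<le> 1"
    and H: "H \<in> borel_measurable env"
  shows "(\<integral>\<^sup>+\<omega>. H \<omega> * (\<Prod>k<pop (offspring \<omega>) m. ennreal ((if k \<in> clan (offspring \<omega>) i m then t \<omega> else s \<omega>) ^ \<xi> (Suc m) k \<omega>)) \<partial>M)
    = (\<integral>\<^sup>+\<omega>. H \<omega> * (\<Prod>k<pop (offspring \<omega>) m. ennreal (gen_fun (Fs (Suc m) \<omega>) (if k \<in> clan (offspring \<omega>) i m then t \<omega> else s \<omega>))) \<partial>M)"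
proof -
  let ?w = "\<lambda>k \<omega>. if k \<in> clan (offspring \<omega>) i m then t \<omega> else s \<omega>"
  let ?N = "\<lambda>\<omega>. pop (offspring \<omega>) m"
  note env = measurable_from_subalg[OF subalgebra_history_env]
  note toM = measurable_from_subalg[OF subalgebra_past[of m]]
  have w: "?w k \<in> borel_measurable (past m)" for k
    by (intro measurable_If env s t) (use clan_measurable_past[of k i m] in \<open>simp add: pred_def\<close>)
  have HN: "(\<lambda>\<omega>. H \<omega> * indicator {p} (?N \<omega>)) \<in> borel_measurable (past m)" for p
    by (intro borel_measurable_times_ennreal env H borel_measurable_indicator_count_space pop_measurable_past)
  have step: "(\<integral>\<^sup>+\<omega>. (H \<omega> * indicator {p} (?N \<omega>)) * (\<Prod>k<p. ennreal (?w k \<omega> ^ \<xi> (Suc m) k \<omega>)) \<partial>M)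
    = (\<integral>\<^sup>+\<omega>. (H \<omega> * indicator {p} (?N \<omega>)) * (\<Prod>k<p. ennreal (gen_fun (Fs (Suc m) \<omega>) (?w k \<omega>))) \<partial>M)" for p
    by (rule nn_integral_prod_offspring[OF _ _ _ w _ _ HN]) (use s t in auto)
  note [measurable] = toM[OF w] toM[OF env[OF H]] toM[OF pop_measurable_past]
    offspring_measurable[of "Suc m", simplified] Fs_measurable_M[of "Suc m", simplified]
  have m1: "(\<lambda>\<omega>. \<Prod>k<?N \<omega>. ennreal (?w k \<omega> ^ \<xi> (Suc m) k \<omega>)) \<in> borel_measurable M"
    by (rule measurable_compose_countable'[OF _ toM[OF pop_measurable_past]]) (simp_all, measurable)
  have m2: "(\<lambda>\<omega>. \<Prod>k<?N \<omega>. ennreal (gen_fun (Fs (Suc m) \<omega>) (?w k \<omega>))) \<in> borel_measurable M"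
    by (rule measurable_compose_countable'[OF _ toM[OF pop_measurable_past]]) (simp_all, measurable)
  note [measurable] = m1 m2
  have "(\<integral>\<^sup>+\<omega>. H \<omega> * (\<Prod>k<?N \<omega>. ennreal (?w k \<omega> ^ \<xi> (Suc m) k \<omega>)) \<partial>M)
      = (\<Sum>p. \<integral>\<^sup>+\<omega>. (H \<omega> * (\<Prod>k<?N \<omega>. ennreal (?w k \<omega> ^ \<xi> (Suc m) k \<omega>))) * indicator {p} (?N \<omega>) \<partial>M)"
    by (rule nn_integral_partition_nat) measurable
  also have "\<dots> = (\<Sum>p. \<integral>\<^sup>+\<omega>. (H \<omega> * indicator {p} (?N \<omega>)) * (\<Prod>k<p. ennreal (?w k \<omega> ^ \<xi> (Suc m) k \<omega>)) \<partial>M)"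
    by (intro suminf_cong nn_integral_cong) (simp add: indicator_def)
  also have "\<dots> = (\<Sum>p. \<integral>\<^sup>+\<omega>. (H \<omega> * indicator {p} (?N \<omega>)) * (\<Prod>k<p. ennreal (gen_fun (Fs (Suc m) \<omega>) (?w k \<omega>))) \<partial>M)"
    by (simp only: step)
  also have "\<dots> = (\<Sum>p. \<integral>\<^sup>+\<omega>. (H \<omega> * (\<Prod>k<?N \<omega>. ennreal (gen_fun (Fs (Suc m) \<omega>) (?w k \<omega>)))) * indicator {p} (?N \<omega>) \<partial>M)"
    by (intro suminf_cong nn_integral_cong) (simp add: indicator_def)
  also have "\<dots> = (\<integral>\<^sup>+\<omega>. H \<omega> * (\<Prod>k<?N \<omega>. ennreal (gen_fun (Fs (Suc m) \<omega>) (?w k \<omega>))) \<partial>M)"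
    by (rule nn_integral_partition_nat[symmetric]) measurable
  finally show ?thesis .
qed

abbreviation pgf :: "nat \<Rightarrow> real \<Rightarrow> nat \<Rightarrow> 'a \<Rightarrow> real" where
  "pgf n s m \<omega> \<equiv> pgf_comp (\<lambda>j. Fs j \<omega>) n (n - m) s"

lemma pgf_comp_measurable:
  "N \<le> n \<Longrightarrow> (\<lambda>\<omega>. pgf_comp (\<lambda>j. Fs j \<omega>) n N s) \<in> borel_measurable env"
proof (induction N)
  case (Suc N)
  then show ?case by (auto intro!: borel_measurable_gen_fun Fs_measurable_env)
qed simp

lemma pgf_Suc: "m < n \<Longrightarrow> pgf n s m \<omega> = gen_fun (Fs (Suc m) \<omega>) (pgf n s (Suc m) \<omega>)"
  by (simp add: Suc_diff_Suc[symmetric])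

lemma nn_integral_pop:
  assumes t: "0 \<le> t" "t \<le> 1" and s: "0 \<le> s" "s \<le> 1" and "m \<le> n" and "H \<in> borel_measurable env"
  shows "(\<integral>\<^sup>+\<omega>. H \<omega> * (\<Prod>l<pop (offspring \<omega>) m. ennreal (if l \<in> clan (offspring \<omega>) i m then pgf n t m \<omega> else pgf n s m \<omega>)) \<partial>M)
    = (\<integral>\<^sup>+\<omega>. H \<omega> * (\<Prod>j\<le>m. ennreal (if j = i then pgf n t j \<omega> else pgf n s j \<omega>)) \<partial>M)"
  using assms(5,6)
proof (induction m arbitrary: H)
  case 0
  then show ?case by (auto intro!: nn_integral_cong)
next
  case (Suc m)
  let ?imm = "\<lambda>\<omega>. ennreal (if i = Suc m then pgf n t (Suc m) \<omega> else pgf n s (Suc m) \<omega>)"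
  let ?c = "\<lambda>k \<omega>. k \<in> clan (offspring \<omega>) i m"
  note [measurable] = Suc.prems(2) pgf_comp_measurable[of "n - Suc m" n t, simplified] pgf_comp_measurable[of "n - Suc m" n s, simplified]
  have meas: "(\<lambda>\<omega>. H \<omega> * ?imm \<omega>) \<in> borel_measurable env" by (cases "i = Suc m") (simp; measurable)+
  have *: "(\<Prod>l<pop (offspring \<omega>) (Suc m). ennreal (if l \<in> clan (offspring \<omega>) i (Suc m) then pgf n t (Suc m) \<omega> else pgf n s (Suc m) \<omega>))
     = ?imm \<omega> * (\<Prod>k<pop (offspring \<omega>) m. ennreal ((if ?c k \<omega> then pgf n t (Suc m) \<omega> else pgf n s (Suc m) \<omega>) ^ \<xi> (Suc m) k \<omega>))" for \<omega>
  proof -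
    have "(\<Prod>l<pop (offspring \<omega>) (Suc m). if l \<in> clan (offspring \<omega>) i (Suc m) then ennreal (pgf n t (Suc m) \<omega>) else ennreal (pgf n s (Suc m) \<omega>))
      = (if i = Suc m then ennreal (pgf n t (Suc m) \<omega>) else ennreal (pgf n s (Suc m) \<omega>)) *
        (\<Prod>k<pop (offspring \<omega>) m. (if ?c k \<omega> then ennreal (pgf n t (Suc m) \<omega>) else ennreal (pgf n s (Suc m) \<omega>)) ^ \<xi> (Suc m) k \<omega>)"
      by (rule prod_pop_Suc)
    moreover have "ennreal (a ^ k) = ennreal a ^ k" if "0 \<le> a" for a k
      using that by (simp add: ennreal_power)
    ultimately show ?thesis
      using pgf_comp_bounds[OF t] pgf_comp_bounds[OF s]
      by (simp only: if_distrib[of ennreal] if_distrib[of "\<lambda>a. a ^ _"] cong: if_cong)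
  qed
  have "(\<integral>\<^sup>+\<omega>. H \<omega> * (\<Prod>l<pop (offspring \<omega>) (Suc m). ennreal (if l \<in> clan (offspring \<omega>) i (Suc m) then pgf n t (Suc m) \<omega> else pgf n s (Suc m) \<omega>)) \<partial>M)
      = (\<integral>\<^sup>+\<omega>. (H \<omega> * ?imm \<omega>) * (\<Prod>k<pop (offspring \<omega>) m. ennreal ((if ?c k \<omega> then pgf n t (Suc m) \<omega> else pgf n s (Suc m) \<omega>) ^ \<xi> (Suc m) k \<omega>)) \<partial>M)"
    unfolding * by (simp only: mult.assoc)
  also have "\<dots> = (\<integral>\<^sup>+\<omega>. (H \<omega> * ?imm \<omega>) * (\<Prod>k<pop (offspring \<omega>) m. ennreal (gen_fun (Fs (Suc m) \<omega>) (if ?c k \<omega> then pgf n t (Suc m) \<omega> else pgf n s (Suc m) \<omega>))) \<partial>M)"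
    using pgf_comp_bounds[OF t] pgf_comp_bounds[OF s]
    by (intro nn_integral_generation pgf_comp_measurable meas) auto
  also have "\<dots> = (\<integral>\<^sup>+\<omega>. (H \<omega> * ?imm \<omega>) * (\<Prod>k<pop (offspring \<omega>) m. ennreal (if ?c k \<omega> then pgf n t m \<omega> else pgf n s m \<omega>)) \<partial>M)"
    using Suc.prems(1) by (simp only: if_distrib[of "gen_fun _"] pgf_Suc Suc_le_eq)
  also have "\<dots> = (\<integral>\<^sup>+\<omega>. (H \<omega> * ?imm \<omega>) * (\<Prod>j\<le>m. ennreal (if j = i then pgf n t j \<omega> else pgf n s j \<omega>)) \<partial>M)"
    using Suc.prems(1) meas by (intro Suc.IH) auto
  finally show ?case by (simp add: mult_ac eq_commute[of i] cong: if_cong)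
qed

lemma nn_integral_pop_before:
  assumes t: "0 \<le> t" "t \<le> 1"
  shows "(\<integral>\<^sup>+\<omega>. ennreal (\<Prod>l<pop_before (offspring \<omega>) (Suc m). if l \<in> clan (offspring \<omega>) i (Suc m) then t else 0) \<partial>M)
    = (\<integral>\<^sup>+\<omega>. ennreal (\<Prod>j\<le>m. if j = i then pgf (Suc m) t j \<omega> else pgf (Suc m) 0 j \<omega>) \<partial>M)"
proof -
  let ?c = "\<lambda>k \<omega>. k \<in> clan (offspring \<omega>) i m"
  have "(\<integral>\<^sup>+\<omega>. ennreal (\<Prod>l<pop_before (offspring \<omega>) (Suc m). if l \<in> clan (offspring \<omega>) i (Suc m) then t else 0) \<partial>M)
      = (\<integral>\<^sup>+\<omega>. 1 * (\<Prod>k<pop (offspring \<omega>) m. ennreal ((if ?c k \<omega> then t else 0) ^ \<xi> (Suc m) k \<omega>)) \<partial>M)"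
    using t by (simp only: prod_pop_before) (simp add: prod_ennreal)
  also have "\<dots> = (\<integral>\<^sup>+\<omega>. 1 * (\<Prod>k<pop (offspring \<omega>) m. ennreal (gen_fun (Fs (Suc m) \<omega>) (if ?c k \<omega> then t else 0))) \<partial>M)"
    using t by (intro nn_integral_generation) auto
  also have "\<dots> = (\<integral>\<^sup>+\<omega>. 1 * (\<Prod>k<pop (offspring \<omega>) m. ennreal (if ?c k \<omega> then pgf (Suc m) t m \<omega> else pgf (Suc m) 0 m \<omega>)) \<partial>M)"
    by (simp add: if_distrib[of "gen_fun _"] Suc_diff_le cong: if_cong)
  also have "\<dots> = (\<integral>\<^sup>+\<omega>. 1 * (\<Prod>j\<le>m. ennreal (if j = i then pgf (Suc m) t j \<omega> else pgf (Suc m) 0 j \<omega>)) \<partial>M)"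
    using t by (intro nn_integral_pop) auto
  finally show ?thesis
    using pgf_comp_bounds[OF t] pgf_comp_bounds[of 0] by (simp add: prod_ennreal)
qed

end

section \<open>Clan probabilities\<close>

lemma prod_if_less_zero: "(\<Prod>l<n. if P l then 1 else (0::real)) = of_bool (\<forall>l<n. P l)" for n :: nat
  by (induction n) (auto simp: less_Suc_eq)

lemma prod_walk_sum_ratio:
  "(\<Prod>N<n. walk_sum (Suc N) x / walk_sum (Suc (Suc N)) x) = inverse (walk_sum (Suc n) x)"
proof (induction n)
  case (Suc n)
  then show ?case using walk_sum_pos[of "Suc n" x] by (simp add: divide_inverse)
qed (simp add: walk_sum_Suc)

lemma pgf_comp_geometric:
  assumes "\<And>k. 1 \<le> k \<Longrightarrow> k \<le> n \<Longrightarrow> f k \<in> geometric_pmf_set" and "N \<le> n"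
    and x: "\<And>l. l < n \<Longrightarrow> x l = ln (offspring_mean (f (n - l)))"
  shows "pgf_comp f n N 0 = walk_sum N x / walk_sum (Suc N) x"
  using assms(2)
proof (induction N)
  case (Suc N)
  define a w where "a = walk_sum (Suc N) x" and "w = walk_exp N x"
  have a: "a > 0" unfolding a_def by (rule walk_sum_pos) simp
  have fk: "f (n - N) \<in> geometric_pmf_set" using Suc.prems by (intro assms(1)) auto
  have m: "offspring_mean (f (n - N)) = exp (x N)"
    using Suc.prems x[of N] geometric_gen_fun(1)[OF fk] by simp
  have q: "1 - walk_sum N x / a = w / a"
    using a by (simp add: a_def w_def walk_sum_Suc field_simps)
  have b: "0 \<le> walk_sum N x / a" "walk_sum N x / a \<le> 1"
    using a walk_sum_mono[of 0 N x] walk_sum_mono[of N "Suc N" x] by (simp_all add: a_def)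
  have "pgf_comp f n (Suc N) 0 = gen_fun (f (n - N)) (walk_sum N x / a)"
    using Suc by (simp add: a_def)
  also have "\<dots> = 1 / (1 + exp (x N) * (w / a))"
    using geometric_gen_fun(2)[OF fk b] by (simp add: m q)
  also have "\<dots> = a / (a + w * exp (x N))"
    using a by (simp add: field_simps)
  finally show ?case
    by (simp add: a_def w_def walk_sum_Suc[of "Suc N"] walk_exp_Suc)
qed (simp add: walk_sum_Suc)

context bpire
begin

lemma clan_event_prob:
  assumes "i \<le> m"
  shows "measure M (clan_event M \<xi> i (Suc m)) =
    (\<integral>\<omega>. (\<Prod>j\<le>m. if j = i then 1 else pgf (Suc m) 0 j \<omega>) - (\<Prod>j\<le>m. pgf (Suc m) 0 j \<omega>) \<partial>M)"
proof -
  let ?pb = "\<lambda>\<omega>. pop_before (offspring \<omega>) (Suc m)"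
  let ?g = "\<lambda>t \<omega>. \<Prod>j\<le>m. if j = i then pgf (Suc m) t j \<omega> else pgf (Suc m) 0 j \<omega>"
  note toM = measurable_from_subalg[OF subalgebra_past[of "Suc m"]]
  have pb [measurable]: "?pb \<in> M \<rightarrow>\<^sub>M count_space UNIV"
    using measurable_compose[OF toM[OF pop_measurable_past], of "\<lambda>a. a - 1"] by (simp add: pop_before_def)
  have [measurable]: "(\<lambda>\<omega>. l \<in> clan (offspring \<omega>) i (Suc m)) \<in> M \<rightarrow>\<^sub>M count_space UNIV" for l
    by (rule toM[OF clan_measurable_past])
  have [measurable]: "(\<lambda>\<omega>. l < ?pb \<omega>) \<in> M \<rightarrow>\<^sub>M count_space UNIV" for l
    by (rule measurable_compose[OF pb]) simp
  define E where "E t = {\<omega>\<in>space M. \<forall>l<?pb \<omega>. t = (1::real) \<and> l \<in> clan (offspring \<omega>) i (Suc m)}" for t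
  have E [measurable]: "E t \<in> sets M" for t unfolding E_def by measurable
  have int: "integrable M (?g t)" "measure M (E t) = (\<integral>\<omega>. ?g t \<omega> \<partial>M)" if t: "t = 0 \<or> t = 1" for t
  proof -
    have t01: "0 \<le> t" "t \<le> 1" using t by auto
    have 01: "0 \<le> ?g t \<omega>" "?g t \<omega> \<le> 1" for \<omega>
      using pgf_comp_bounds[OF t01] pgf_comp_bounds[of 0] by (auto intro!: prod_nonneg prod_le_1)
    have "?g t \<in> borel_measurable env"
      by (intro borel_measurable_prod measurable_If pgf_comp_measurable) auto
    then have [measurable]: "?g t \<in> borel_measurable M"
      by (rule measurable_from_subalg[OF subalgebra_env])
    show int: "integrable M (?g t)"
      by (rule integrable_const_bound[where B = 1]) (use 01 in \<open>auto simp: abs_of_nonneg\<close>)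
    have "emeasure M (E t) = (\<integral>\<^sup>+\<omega>. indicator (E t) \<omega> \<partial>M)" by simp
    also have "\<dots> = (\<integral>\<^sup>+\<omega>. ennreal (\<Prod>l<?pb \<omega>. if l \<in> clan (offspring \<omega>) i (Suc m) then t else 0) \<partial>M)"
    proof (rule nn_integral_cong)
      fix \<omega> assume "\<omega> \<in> space M"
      have "(\<Prod>l<?pb \<omega>. if l \<in> clan (offspring \<omega>) i (Suc m) then t else 0)
          = (\<Prod>l<?pb \<omega>. if t = 1 \<and> l \<in> clan (offspring \<omega>) i (Suc m) then 1 else 0)"
        using t by (intro prod.cong) auto
      also have "\<dots> = indicator (E t) \<omega>"
        unfolding prod_if_less_zero using \<open>\<omega> \<in> space M\<close> by (simp add: E_def indicator_def)
      finally show "indicator (E t) \<omega> = ennreal (\<Prod>l<?pb \<omega>. if l \<in> clan (offspring \<omega>) i (Suc m) then t else 0)"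
        by (simp add: indicator_def)
    qed
    also have "\<dots> = (\<integral>\<^sup>+\<omega>. ennreal (?g t \<omega>) \<partial>M)"
      by (rule nn_integral_pop_before[OF t01])
    also have "\<dots> = ennreal (\<integral>\<omega>. ?g t \<omega> \<partial>M)"
      using 01 by (intro nn_integral_eq_integral int) simp
    finally show "measure M (E t) = (\<integral>\<omega>. ?g t \<omega> \<partial>M)"
      using 01 by (simp add: measure_def Bochner_Integration.integral_nonneg)
  qed
  have "clan_event M \<xi> i (Suc m) = E 1 - E 0"
    by (auto simp: clan_event_def only_clan_survives_def E_def subset_eq simp del: clan.simps)
  moreover have "E 0 \<subseteq> E 1" by (auto simp: E_def)
  ultimately have "measure M (clan_event M \<xi> i (Suc m)) = measure M (E 1) - measure M (E 0)"
    using finite_measure_Diff[OF E E] by simp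
  also have "\<dots> = (\<integral>\<omega>. ?g 1 \<omega> - ?g 0 \<omega> \<partial>M)"
    using int[of 0] int[of 1] by simp
  finally show ?thesis by (simp only: pgf_comp_1 if_cancel)
qed

abbreviation log_mean :: "nat pmf \<Rightarrow> real" where
  "log_mean f \<equiv> ln (offspring_mean f)"

lemma clan_event_prob_geometric:
  assumes geo: "AE \<omega> in M. geometric_law (F \<omega>)" and "i < n"
  shows "measure M (clan_event M \<xi> i n) =
    (\<integral>\<omega>. walk_exp (n - i) (\<lambda>l. log_mean (Fs (n - l) \<omega>)) *
      (inverse (walk_sum (n - i) (\<lambda>l. log_mean (Fs (n - l) \<omega>))) *
       inverse (walk_sum (Suc n) (\<lambda>l. log_mean (Fs (n - l) \<omega>)))) \<partial>M)"
    (is "_ = (\<integral>\<omega>. ?G \<omega> \<partial>M)")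
proof -
  obtain m where n: "n = Suc m" using \<open>i < n\<close> by (cases n) auto
  have "i \<le> m" using \<open>i < n\<close> n by simp
  have "AE f in distr M pmf_borel F. f \<in> geometric_pmf_set"
    using geo F_measurable by (subst AE_distr_iff) (auto intro: geometric_law_imp)
  then have "AE \<omega> in M. Fs k \<omega> \<in> geometric_pmf_set" if "k \<ge> 1" for k
    unfolding env_distr[OF that, symmetric] by (rule AE_distrD[OF Fs_measurable_M[OF that]])
  then have ae: "AE \<omega> in M. \<forall>k\<in>{1..n}. Fs k \<omega> \<in> geometric_pmf_set"
    by (intro AE_finite_allI) auto
  have "measure M (clan_event M \<xi> i n) =
    (\<integral>\<omega>. (\<Prod>j\<le>m. if j = i then 1 else pgf n 0 j \<omega>) - (\<Prod>j\<le>m. pgf n 0 j \<omega>) \<partial>M)"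
    unfolding n by (rule clan_event_prob[OF \<open>i \<le> m\<close>])
  also have "\<dots> = (\<integral>\<omega>. ?G \<omega> \<partial>M)"
  proof (rule integral_cong_AE)
    have pm: "pgf n s j \<in> borel_measurable M" for s j
      by (intro measurable_from_subalg[OF subalgebra_env] pgf_comp_measurable) simp
    note [measurable] = pm
    show "(\<lambda>\<omega>. (\<Prod>j\<le>m. if j = i then 1 else pgf n 0 j \<omega>) - (\<Prod>j\<le>m. pgf n 0 j \<omega>)) \<in> borel_measurable M"
      by measurable
    have [measurable]: "(\<lambda>\<omega>. log_mean (Fs (n - l) \<omega>)) \<in> borel_measurable M" if "l < n" for l
      using that measurable_compose[OF Fs_measurable_M borel_measurable_offspring_mean, of "n - l"] by simp
    have [measurable]: "(\<lambda>\<omega>. walk_exp k (\<lambda>l. log_mean (Fs (n - l) \<omega>))) \<in> borel_measurable M" if "k \<le> n" for k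
      unfolding walk_exp_def using that
      by (intro measurable_compose[OF _ borel_measurable_exp] borel_measurable_sum) auto
    have [measurable]: "(\<lambda>\<omega>. walk_sum k (\<lambda>l. log_mean (Fs (n - l) \<omega>))) \<in> borel_measurable M" if "k \<le> Suc n" for k
      unfolding walk_sum_def using that by (intro borel_measurable_sum) auto
    show "?G \<in> borel_measurable M" by measurable
    show "AE \<omega> in M. (\<Prod>j\<le>m. if j = i then 1 else pgf n 0 j \<omega>) - (\<Prod>j\<le>m. pgf n 0 j \<omega>) = ?G \<omega>"
      using ae
    proof eventually_elim
      fix \<omega> assume ok: "\<forall>k\<in>{1..n}. Fs k \<omega> \<in> geometric_pmf_set"
      define x where "x l = log_mean (Fs (n - l) \<omega>)" for l
      have pgf: "pgf_comp (\<lambda>j. Fs j \<omega>) n N 0 = walk_sum N x / walk_sum (Suc N) x" if "N \<le> n" for N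
        using ok that by (intro pgf_comp_geometric) (auto simp: x_def)
      define P where "P = (\<Prod>j\<in>{..m} - {i}. pgf n 0 j \<omega>)"
      have "(\<Prod>j\<le>m. pgf n 0 j \<omega>) = (\<Prod>j<n. walk_sum (Suc (n - Suc j)) x / walk_sum (Suc (Suc (n - Suc j))) x)"
        using pgf by (intro prod.cong) (auto simp only: n lessThan_Suc_atMost Suc_diff_Suc diff_le_self)
      also have "\<dots> = inverse (walk_sum (Suc n) x)"
        by (subst prod.nat_diff_reindex[where g = "\<lambda>N. walk_sum (Suc N) x / walk_sum (Suc (Suc N)) x"])
           (rule prod_walk_sum_ratio)
      finally have all: "(\<Prod>j\<le>m. pgf n 0 j \<omega>) = inverse (walk_sum (Suc n) x)" .
      have r1: "(\<Prod>j\<le>m. pgf n 0 j \<omega>) = pgf n 0 i \<omega> * P"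
        unfolding P_def using \<open>i \<le> m\<close> by (intro prod.remove) auto
      have r2: "(\<Prod>j\<le>m. if j = i then 1 else pgf n 0 j \<omega>) = P"
        unfolding P_def using \<open>i \<le> m\<close> by (subst prod.remove[of _ i]) (auto intro!: prod.cong)
      define a w b where "a = walk_sum (n - i) x" and "w = walk_exp (n - i) x" and "b = inverse (walk_sum (Suc n) x)"
      have a: "a > 0" "w > 0" using \<open>i < n\<close> by (simp_all add: a_def w_def walk_sum_pos)
      have "pgf n 0 i \<omega> = a / (a + w)"
        using pgf[of "n - i"] by (simp add: a_def w_def walk_sum_Suc)
      with r1 all have "b = a / (a + w) * P" by (simp add: b_def)
      then have "P - b = w * (inverse a * b)"
        using a by (simp add: field_simps)
      then have "(\<Prod>j\<le>m. if j = i then 1 else pgf n 0 j \<omega>) - (\<Prod>j\<le>m. pgf n 0 j \<omega>)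
          = walk_exp (n - i) x * (inverse (walk_sum (n - i) x) * inverse (walk_sum (Suc n) x))"
        unfolding r2 all a_def w_def b_def .
      then show "(\<Prod>j\<le>m. if j = i then 1 else pgf n 0 j \<omega>) - (\<Prod>j\<le>m. pgf n 0 j \<omega>) = ?G \<omega>"
        unfolding x_def[abs_def] .
    qed
  qed
  finally show ?thesis .
qed

lemma integral_reversed_environment:
  fixes G :: "(nat \<Rightarrow> real) \<Rightarrow> real"
  defines "Q \<equiv> distr M borel (\<lambda>\<omega>. log_mean (F \<omega>))"
  assumes [measurable]: "G \<in> borel_measurable (PiM UNIV (\<lambda>_. borel))"
    and G: "\<And>x y. (\<And>l. l < n \<Longrightarrow> x l = y l) \<Longrightarrow> G x = G y" and n: "n \<ge> 1"
  shows "(\<integral>\<omega>. G (\<lambda>l. log_mean (Fs (n - l) \<omega>)) \<partial>M) = (\<integral>x. G x \<partial>PiM UNIV (\<lambda>_. Q))"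
proof -
  let ?P = "\<Pi>\<^sub>M k\<in>{1..n}. (borel :: real measure)"
  have lm [measurable]: "log_mean \<in> borel_measurable pmf_borel" by measurable
  note [measurable] = F_measurable
  have Q: "prob_space Q" unfolding Q_def by (rule prob_space_distr) measurable
  have sQ [measurable_cong]: "sets Q = sets borel" by (simp add: Q_def)
  have dk: "distr M borel (\<lambda>\<omega>. log_mean (Fs k \<omega>)) = Q" if "k \<ge> 1" for k
  proof -
    have "distr M borel (\<lambda>\<omega>. log_mean (Fs k \<omega>)) = distr (distr M pmf_borel (Fs k)) borel log_mean"
      using Fs_measurable_M[OF that] by (simp add: distr_distr comp_def)
    also have "\<dots> = Q"
      unfolding env_distr[OF that] Q_def by (simp add: distr_distr comp_def)
    finally show ?thesis .
  qed
  have "indep_vars (\<lambda>_. borel) (\<lambda>k \<omega>. log_mean (Fs k \<omega>)) {1..n}"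
    by (rule indep_vars_compose2[OF indep_vars_subset[OF env_indep]]) auto
  then have joint: "distr M ?P (\<lambda>\<omega>. \<lambda>k\<in>{1..n}. log_mean (Fs k \<omega>)) = (\<Pi>\<^sub>M k\<in>{1..n}. Q)"
    using n by (subst (asm) indep_vars_iff_distr_eq_PiM')
      (auto simp: dk intro!: measurable_compose[OF Fs_measurable_M lm] PiM_cong cong: PiM_cong)
  define \<Phi> where "\<Phi> z = G (\<lambda>l. if l < n then z (n - l) else 0)" for z
  have [measurable]: "(\<lambda>z l. if l < n then z (n - l) else 0) \<in> ?P \<rightarrow>\<^sub>M PiM UNIV (\<lambda>_. borel)"
  proof (rule measurable_PiM_single')
    fix l
    show "(\<lambda>z. if l < n then z (n - l) else (0::real)) \<in> borel_measurable ?P"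
      by (cases "l < n") (auto intro!: measurable_component_singleton)
  qed (auto simp: space_PiM)
  have \<Phi> [measurable]: "\<Phi> \<in> borel_measurable ?P" unfolding \<Phi>_def by measurable
  have "(\<integral>\<omega>. G (\<lambda>l. log_mean (Fs (n - l) \<omega>)) \<partial>M) = (\<integral>\<omega>. \<Phi> (\<lambda>k\<in>{1..n}. log_mean (Fs k \<omega>)) \<partial>M)"
    unfolding \<Phi>_def by (intro Bochner_Integration.integral_cong refl G) auto
  also have "\<dots> = (\<integral>z. \<Phi> z \<partial>distr M ?P (\<lambda>\<omega>. \<lambda>k\<in>{1..n}. log_mean (Fs k \<omega>)))"
    by (intro integral_distr[symmetric] measurable_restrict measurable_compose[OF Fs_measurable_M lm] \<Phi>) auto
  also have "\<dots> = (\<integral>z. \<Phi> z \<partial>distr (PiM UNIV (\<lambda>_. Q)) (\<Pi>\<^sub>M k\<in>{1..n}. Q) (\<lambda>x. \<lambda>k\<in>{1..n}. x (n - k)))"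
    unfolding joint using Q
    by (subst distr_PiM_reindex[of UNIV "\<lambda>_. Q" "\<lambda>k. n - k" "{1..n}"]) (auto simp: inj_on_def)
  also have "\<dots> = (\<integral>x. \<Phi> (\<lambda>k\<in>{1..n}. x (n - k)) \<partial>PiM UNIV (\<lambda>_. Q))"
    by (intro integral_distr measurable_restrict measurable_component_singleton)
       (use \<Phi> in \<open>simp_all cong: measurable_cong_sets sets_PiM_cong add: sQ\<close>)
  also have "\<dots> = (\<integral>x. G x \<partial>PiM UNIV (\<lambda>_. Q))"
    unfolding \<Phi>_def by (intro Bochner_Integration.integral_cong refl G) auto
  finally show ?thesis .
qed

end

theorem theorem1:
  fixes M :: "'a measure"
    and F :: "'a \<Rightarrow> nat pmf"
    and Fs :: "nat \<Rightarrow> 'a \<Rightarrow> nat pmf"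
    and \<xi> :: "nat \<Rightarrow> nat \<Rightarrow> 'a \<Rightarrow> nat"
    and X :: "'a \<Rightarrow> real"
    and \<gamma> :: real
  defines "X \<equiv> \<lambda>\<omega>. ln (offspring_mean (F \<omega>))"
    and "\<gamma> \<equiv> (\<integral>\<omega>. exp (X \<omega>) \<partial>M)"
  assumes "bpire M F Fs \<xi>"
    and "AE \<omega> in M. geometric_law (F \<omega>)"
    and "integrable M X"
    and "(\<integral>\<omega>. X \<omega> \<partial>M) < 0"
    and "integrable M (\<lambda>\<omega>. X \<omega> * exp (X \<omega>))"
    and "(\<integral>\<omega>. X \<omega> * exp (X \<omega>) \<partial>M) < 0"
  shows "(\<forall>N\<ge>1. \<exists>r>0. (\<lambda>n. measure M (clan_event M \<xi> (n - N) n)) \<longlonglongrightarrow> r) \<and>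
    (\<exists>R>0. ((\<lambda>(i, n). \<gamma> powi (- (int n - int i)) * measure M (clan_event M \<xi> i n)) \<longlongrightarrow> R)
       (inf (filtercomap (\<lambda>(i, n). n - i) at_top) (principal {(i, n). i < n})))"
proof -
  interpret bpire M F Fs \<xi> by fact
  define Q where "Q = distr M borel X"
  have X [measurable]: "X \<in> borel_measurable M"
    using assms(5) by auto
  have Q: "prob_space Q" unfolding Q_def by (rule prob_space_distr) measurable
  have \<gamma>: "\<gamma> \<equiv> (\<integral>x. exp x \<partial>Q)"
    unfolding \<gamma>_def Q_def by (subst integral_distr) simp_all
  interpret Q: prob_space Q by (rule Q)
  interpret W: strongly_subcritical_walk Q \<gamma>
  proof (unfold_locales)
    show "sets Q = sets borel" by (simp add: Q_def)
    show "\<gamma> \<equiv> (\<integral>x. exp x \<partial>Q)" by (rule \<gamma>)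
    show "integrable Q (\<lambda>x. x * exp x)" using assms(7) unfolding Q_def by (subst integrable_distr_eq) simp_all
    show "(\<integral>x. x * exp x \<partial>Q) < 0" using assms(8) unfolding Q_def by (subst integral_distr) simp_all
  qed
  have prob: "measure M (clan_event M \<xi> i n) = W.clan_prob (n - i) n" if "i < n" for i n
  proof -
    let ?G = "\<lambda>x. walk_exp (n - i) x * (inverse (walk_sum (n - i) x) * inverse (walk_sum (Suc n) x))"
    have "measure M (clan_event M \<xi> i n) = (\<integral>\<omega>. ?G (\<lambda>l. ln (offspring_mean (Fs (n - l) \<omega>))) \<partial>M)"
      by (rule clan_event_prob_geometric[OF assms(4) that])
    also have "\<dots> = (\<integral>x. ?G x \<partial>PiM UNIV (\<lambda>_. distr M borel (\<lambda>\<omega>. ln (offspring_mean (F \<omega>)))))"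
    proof (rule integral_reversed_environment)
      show "?G \<in> borel_measurable (PiM UNIV (\<lambda>_. borel))"
        unfolding walk_exp_def walk_sum_def by measurable
      show "?G x = ?G y" if "\<And>l. l < n \<Longrightarrow> x l = y l" for x y
        using that walk_exp_cong[of "n - i" x y] walk_sum_cong[of "n - i" x y] walk_sum_cong[of "Suc n" x y] by simp
    qed (use that in simp)
    finally show ?thesis unfolding W.clan_prob_def by (simp only: Q_def X_def)
  qed
  have "\<exists>r>0. (\<lambda>n. measure M (clan_event M \<xi> (n - N) n)) \<longlonglongrightarrow> r" if N: "N \<ge> 1" for N
  proof -
    obtain r where r: "r > 0" "W.clan_prob N \<longlonglongrightarrow> r"
      using W.clan_prob_limit_fixed[of N] N by auto
    have "\<forall>\<^sub>F n in sequentially. W.clan_prob N n = measure M (clan_event M \<xi> (n - N) n)"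
      using eventually_ge_at_top[of N] by eventually_elim (use N in \<open>simp add: prob\<close>)
    with r show ?thesis by (blast intro: Lim_transform_eventually)
  qed
  moreover obtain R where R: "R > 0" "W.tilted_inverse_square \<longlonglongrightarrow> R"
    "(\<lambda>N. W.tilted_inverse_square N - (W.tilted_inverse N - W.tilted_inverse (Suc N)) / (1 - \<gamma>)) \<longlonglongrightarrow> R"
    by (rule W.tilted_limit)
  let ?F = "inf (filtercomap (\<lambda>(i, n). n - i) at_top) (principal {(i, n). i < n}) :: (nat \<times> nat) filter"
  have lim: "filterlim (\<lambda>(i, n). n - i) sequentially ?F"
    by (rule filterlim_mono[OF filterlim_filtercomap order_refl]) simp
  have ev: "\<forall>\<^sub>F (i, n) in ?F. i < n"
    by (simp add: eventually_inf_principal case_prod_beta)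
  have val: "\<gamma> powi (- (int n - int i)) * measure M (clan_event M \<xi> i n)
      = W.clan_prob (n - i) n / \<gamma> ^ (n - i)" if "i < n" for i n
  proof -
    have "int n - int i = int (n - i)" using that by simp
    then show ?thesis
      by (simp only: prob[OF that] power_int_minus power_int_of_nat divide_inverse mult.commute)
  qed
  have "((\<lambda>(i, n). \<gamma> powi (- (int n - int i)) * measure M (clan_event M \<xi> i n)) \<longlongrightarrow> R) ?F"
  proof (rule tendsto_sandwich)
    show "((\<lambda>z. (\<lambda>N. W.tilted_inverse_square N - (W.tilted_inverse N - W.tilted_inverse (Suc N)) / (1 - \<gamma>))
        ((\<lambda>(i, n). n - i) z)) \<longlongrightarrow> R) ?F"
      by (rule filterlim_compose[OF R(3) lim])
    show "((\<lambda>z. W.tilted_inverse_square ((\<lambda>(i, n). n - i) z)) \<longlongrightarrow> R) ?F"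
      by (rule filterlim_compose[OF R(2) lim])
    show "\<forall>\<^sub>F z in ?F. (\<lambda>N. W.tilted_inverse_square N - (W.tilted_inverse N - W.tilted_inverse (Suc N)) / (1 - \<gamma>))
        ((\<lambda>(i, n). n - i) z) \<le> (\<lambda>(i, n). \<gamma> powi (- (int n - int i)) * measure M (clan_event M \<xi> i n)) z"
      using ev
    proof eventually_elim
      case (elim z)
      obtain i n where z: "z = (i, n)" "i < n" using elim by auto
      then obtain K where K: "n - i = Suc K" by (metis Suc_diff_Suc)
      then have "Suc K \<le> n" by (metis diff_le_self)
      then show ?case
        using W.clan_prob_lower[of K n] unfolding z(1) prod.case val[OF z(2)] K by simp
    qed
    show "\<forall>\<^sub>F z in ?F. (\<lambda>(i, n). \<gamma> powi (- (int n - int i)) * measure M (clan_event M \<xi> i n)) z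
        \<le> W.tilted_inverse_square ((\<lambda>(i, n). n - i) z)"
      using ev
    proof eventually_elim
      case (elim z)
      obtain i n where z: "z = (i, n)" "i < n" using elim by auto
      then obtain K where K: "n - i = Suc K" by (metis Suc_diff_Suc)
      then have "Suc K \<le> n" by (metis diff_le_self)
      then show ?case
        using W.clan_prob_upper[of K n] unfolding z(1) prod.case val[OF z(2)] K by simp
    qed
  qed
  with R(1) have "\<exists>R>0. ((\<lambda>(i, n). \<gamma> powi (- (int n - int i)) * measure M (clan_event M \<xi> i n)) \<longlongrightarrow> R) ?F"
    by blast
  ultimately show ?thesis by blast
qed

end
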